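(* Let $1<p<\infty$ and let $L\in\mathbb{R}$ with $L\neq \pm\frac{4-p}{2(1-p)}$. Set $$\eta=\frac{4-p+2L(1-p)}{4(1-p)},\qquad \tau=\frac{4-p-2L(1-p)}{4(1-p)},$$ $$v(x_1,x_2,x_3)=(x_1^2+x_2^2)-4ix_3,\qquad w(x_1,x_2,x_3)=(x_1^2+x_2^2)+4ix_3,$$ and $$u_{p,L}(x_1,x_2,x_3)=v(x_1,x_2,x_3)^{\eta}\,w(x_1,x_2,x_3)^{\tau}.$$ Then on the Heisenberg group $\mathbb{H}^1$ one has $$\mathcal{H}_{p,L}(u_{p,L}):=\Delta_p u_{p,L}+iL\,[X_1,X_2]\left(\|\nabla_0u_{p,L}\|_{\mathbb{H}}^{p-2}\,u_{p,L}\right)=C\delta_0$$ for some constant $C$, in the sense of distributions.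
   Context: The Heisenberg group $\mathbb{H}^1$ is $\mathbb{R}^3$ with coordinates $(x_1,x_2,x_3)$, group law $$(x_1,x_2,x_3)\cdot(\hat x_1,\hat x_2,\hat x_3)=\left(x_1+\hat x_1,\;x_2+\hat x_2,\;x_3+\hat x_3+\tfrac12(x_1\hat x_2-x_2\hat x_1)\right),$$ and vector fields $$X_1=\frac{\partial}{\partial x_1}-\frac{x_2}{2}\frac{\partial}{\partial x_3},\qquad X_2=\frac{\partial}{\partial x_2}+\frac{x_1}{2}\frac{\partial}{\partial x_3},\qquad X_3=\frac{\partial}{\partial x_3},$$ which satisfy $[X_1,X_2]=X_3$. An inner product, with norm $\|\cdot\|_{\mathbb{H}}$, is chosen so that $X_1,X_2,X_3$ are orthonormal. The horizontal gradient is $\nabla_0u=(X_1u,X_2u)$; for complex-valued $u$, $\|\nabla_0u\|_{\mathbb{H}}^2=X_1u\,\overline{X_1u}+X_2u\,\overline{X_2u}$. The horizontal $p$-Laplacian is $$\Delta_pu=\sum_{i=1}^2X_i\left(\|\nabla_0u\|_{\mathbb{H}}^{p-2}X_iu\right).$$ Since $v$ and $w$ have nonnegative real part and vanish only at the origin, the powers $v^\eta,w^\tau$ are taken with the principal branch away from the origin. $\delta_0$ is the Dirac mass at the origin. *)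

theory Defs
  imports "HOL-Analysis.Analysis"
begin

type_synonym heis = "real^3"

definition partial :: "3 \<Rightarrow> (heis \<Rightarrow> complex) \<Rightarrow> heis \<Rightarrow> complex" where
  "partial i f x = vector_derivative (\<lambda>t. f (x + t *\<^sub>R axis i 1)) (at 0)"

definition X1 :: "(heis \<Rightarrow> complex) \<Rightarrow> heis \<Rightarrow> complex" where
  "X1 f x = partial 1 f x - of_real (x$2 / 2) * partial 3 f x"

definition X2 :: "(heis \<Rightarrow> complex) \<Rightarrow> heis \<Rightarrow> complex" where
  "X2 f x = partial 2 f x + of_real (x$1 / 2) * partial 3 f x"

definition horizontal_grad :: "(heis \<Rightarrow> complex) \<Rightarrow> heis \<Rightarrow> complex \<times> complex" where
  "horizontal_grad f x = (X1 f x, X2 f x)"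

text \<open>The library norm of a pair of complex numbers is the Hermitian norm for which the
  frame is orthonormal.\<close>

lemma norm_horizontal_grad:
  "complex_of_real ((norm (horizontal_grad f x))\<^sup>2)
     = X1 f x * cnj (X1 f x) + X2 f x * cnj (X2 f x)"
  by (simp add: horizontal_grad_def norm_Pair complex_norm_square[symmetric])

primrec Ck :: "nat \<Rightarrow> (heis \<Rightarrow> complex) \<Rightarrow> bool" where
  "Ck 0 f \<longleftrightarrow> continuous_on UNIV f"
| "Ck (Suc k) f \<longleftrightarrow> f differentiable_on UNIV \<and> (\<forall>i. Ck k (partial i f))"

definition test_function :: "(heis \<Rightarrow> complex) \<Rightarrow> bool" where
  "test_function \<phi> \<longleftrightarrow> (\<forall>k. Ck k \<phi>) \<and> compact (closure {x. \<phi> x \<noteq> 0})"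

text \<open>Distributions are represented by functionals, of which only the values on test functions
  matter. Lebesgue measure is the Haar measure of the Heisenberg group, and both frame fields are
  divergence free with respect to it, hence the minus signs in the distributional derivatives.\<close>

type_synonym distr = "(heis \<Rightarrow> complex) \<Rightarrow> complex"

definition distr_eq :: "distr \<Rightarrow> distr \<Rightarrow> bool" where
  "distr_eq S T \<longleftrightarrow> (\<forall>\<phi>. test_function \<phi> \<longrightarrow> S \<phi> = T \<phi>)"

definition locally_integrable :: "(heis \<Rightarrow> complex) \<Rightarrow> bool" where
  "locally_integrable f \<longleftrightarrow> (\<forall>K. compact K \<longrightarrow> set_integrable lborel K f)"

definition distr_of :: "(heis \<Rightarrow> complex) \<Rightarrow> distr" where
  "distr_of f \<phi> = (\<integral>x. f x * \<phi> x \<partial>lborel)"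

definition distr_X1 :: "distr \<Rightarrow> distr" where
  "distr_X1 T \<phi> = - T (X1 \<phi>)"

definition distr_X2 :: "distr \<Rightarrow> distr" where
  "distr_X2 T \<phi> = - T (X2 \<phi>)"

definition distr_bracket :: "(distr \<Rightarrow> distr) \<Rightarrow> (distr \<Rightarrow> distr) \<Rightarrow> distr \<Rightarrow> distr" where
  "distr_bracket P Q T \<phi> = P (Q T) \<phi> - Q (P T) \<phi>"

definition dirac :: distr where
  "dirac \<phi> = \<phi> 0"

text \<open>In the following the derivatives of \<open>u\<close> inside the nonlinear weight are classical and
  only need to exist almost everywhere; the outer derivatives are distributional.\<close>

definition grad_weight :: "real \<Rightarrow> (heis \<Rightarrow> complex) \<Rightarrow> heis \<Rightarrow> complex" where
  "grad_weight p u x = of_real (norm (horizontal_grad u x) powr (p - 2))"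

definition p_Laplacian :: "real \<Rightarrow> (heis \<Rightarrow> complex) \<Rightarrow> distr" where
  "p_Laplacian p u \<phi> =
     distr_X1 (distr_of (\<lambda>x. grad_weight p u x * X1 u x)) \<phi>
   + distr_X2 (distr_of (\<lambda>x. grad_weight p u x * X2 u x)) \<phi>"

definition H_op :: "real \<Rightarrow> real \<Rightarrow> (heis \<Rightarrow> complex) \<Rightarrow> distr" where
  "H_op p L u \<phi> = p_Laplacian p u \<phi>
     + \<i> * of_real L * distr_bracket distr_X1 distr_X2 (distr_of (\<lambda>x. grad_weight p u x * u x)) \<phi>"

text \<open>The Bochner integral of a non-integrable function is \<open>0\<close>; \<open>H_op p L u\<close> is a genuine
  distribution only under this condition.\<close>

definition H_op_defined :: "real \<Rightarrow> (heis \<Rightarrow> complex) \<Rightarrow> bool" where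
  "H_op_defined p u \<longleftrightarrow>
     locally_integrable (\<lambda>x. grad_weight p u x * X1 u x)
   \<and> locally_integrable (\<lambda>x. grad_weight p u x * X2 u x)
   \<and> locally_integrable (\<lambda>x. grad_weight p u x * u x)"

definition v_fun :: "heis \<Rightarrow> complex" where
  "v_fun x = of_real ((x$1)\<^sup>2 + (x$2)\<^sup>2) - 4 * \<i> * of_real (x$3)"

definition w_fun :: "heis \<Rightarrow> complex" where
  "w_fun x = of_real ((x$1)\<^sup>2 + (x$2)\<^sup>2) + 4 * \<i> * of_real (x$3)"

definition eta :: "real \<Rightarrow> real \<Rightarrow> real" where
  "eta p L = (4 - p + 2 * L * (1 - p)) / (4 * (1 - p))"

definition tau :: "real \<Rightarrow> real \<Rightarrow> real" where
  "tau p L = (4 - p - 2 * L * (1 - p)) / (4 * (1 - p))"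

text \<open>Complex \<open>powr\<close> is the principal branch, with value \<open>0\<close> at base \<open>0\<close> (the origin).\<close>

definition u_fun :: "real \<Rightarrow> real \<Rightarrow> heis \<Rightarrow> complex" where
  "u_fun p L x = v_fun x powr of_real (eta p L) * w_fun x powr of_real (tau p L)"

end

theory Submission
  imports Defs
begin

text \<open>
  Off the origin the frame derivatives of \<open>u\<close> are explicit, and the pairing of the operator with a
  test function \<open>\<phi>\<close> has integrand \<open>K * D \<phi> + M * \<Theta> \<phi>\<close> up to sign, where \<open>D\<close> generates the
  Heisenberg dilations and \<open>\<Theta>\<close> the rotations about the vertical axis. The exponents \<open>\<eta>\<close> and \<open>\<tau>\<close>
  are exactly such that \<open>K\<close> is homogeneous of degree \<open>- 4\<close>, so that \<open>K\<close> times Lebesgue measure is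
  invariant under dilations, while \<open>M\<close> is invariant under rotations. Averaging over the flows turns
  the integrals into those of \<open>K * (\<phi> \<circ> \<delta> - \<phi>)\<close> for one fixed dilation \<open>\<delta>\<close> and of
  \<open>M * (\<phi> \<circ> \<rho> - \<phi>)\<close> for the full rotation \<open>\<rho>\<close>; the latter vanishes and the former only sees \<open>\<phi> 0\<close>.
\<close>

subsection \<open>Linear flows and integrals\<close>

text \<open>For \<open>p < 2\<close> the weight blows up along the whole vertical axis and not only
  at the origin, so cutting out a ball and integrating by parts would leave a singular set inside
  the domain. Averaging over a flow asks only for measurability, invariance of the density and an
  integrable majorant; no derivative of the weight is ever taken. The difference \<eta> - \<tau> =
  \<open>L\<close> makes the vertical derivative disappear from the pairing, which is what leaves
  only \<open>D\<close> and \<Theta>. The sum gives \<open>u\<close> the degree 2(\<eta> + \<tau>) =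
  (p - 4)/(p - 1), where 4 = 1 + 1 + 2 is the homogeneous dimension, the exponent by which
  \<open>exp (4 * s)\<close> measures volume growth under dilations. The delicate point is that
  degree -4 in homogeneous dimension 4 is borderline: \<open>K\<close> alone is in general not
  integrable at the origin. Each estimate therefore gains one degree from the other factor: the
  coefficients of the fields vanish at 0, and so does the increment of a Lipschitz function.\<close>

lemma lborel_eq_density_distr_linear:
  fixes g :: "(real, 'n::{finite,wellorder}) vec \<Rightarrow> (real, 'n) vec"
  assumes lin: "linear g" and det: "det (matrix g) \<noteq> 0"
  shows "lborel = density (distr lborel borel g) (\<lambda>_. ennreal \<bar>det (matrix g)\<bar>)"
proof (rule lborel_eqI)
  have [measurable]: "g \<in> borel_measurable borel"
    using lin by (simp add: borel_measurable_continuous_onI linear_continuous_on linear_linear)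
  have bij: "bij g"
    using lin det by (metis bij_def det_nz_iff_inj linear_injective_imp_surjective)
  fix l u :: "(real, 'n) vec"
  assume le: "\<And>b. b \<in> Basis \<Longrightarrow> l \<bullet> b \<le> u \<bullet> b"
  have eq: "g -` box l u = inv g ` box l u"
    by (rule bij_vimage_eq_inv_image[OF bij])
  \<comment> \<open>Writing the preimage as the image of a box under the inverse shows that it has
    finite measure; only then can the rule for images under \<open>g\<close> be applied to
    it.\<close>
  have "linear (inv g)"
    using lin bij by (intro inj_linear_imp_inv_linear bij_is_inj)
  then have meas: "g -` box l u \<in> lmeasurable"
    unfolding eq by (intro measurable_linear_image) auto
  have "measure lebesgue (g ` (g -` box l u)) = \<bar>det (matrix g)\<bar> * measure lebesgue (g -` box l u)"
    using measure_linear_image[OF lin meas] .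
  moreover have "g ` (g -` box l u) = box l u"
    using bij by (simp add: bij_is_surj surj_image_vimage_eq)
  ultimately have m: "\<bar>det (matrix g)\<bar> * measure lebesgue (g -` box l u) = measure lebesgue (box l u)"
    by simp
  have borel: "g -` box l u \<in> sets borel"
    using measurable_sets[of g borel borel "box l u"] by simp
  have "emeasure (density (distr lborel borel g) (\<lambda>_. ennreal \<bar>det (matrix g)\<bar>)) (box l u)
      = ennreal \<bar>det (matrix g)\<bar> * emeasure lborel (g -` box l u)"
    by (simp add: emeasure_density_const emeasure_distr)
  also have "emeasure lborel (g -` box l u) = ennreal (measure lebesgue (g -` box l u))"
    using emeasure_eq_measure2[OF meas] borel by (simp add: emeasure_completion)
  also have "ennreal \<bar>det (matrix g)\<bar> * \<dots> = ennreal (measure lebesgue (box l u))"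
    by (simp flip: m ennreal_mult)
  also have "\<dots> = ennreal (\<Prod>b\<in>Basis. (u - l) \<bullet> b)"
    using le by (simp add: measure_completion)
  finally show "emeasure (density (distr lborel borel g) (\<lambda>_. ennreal \<bar>det (matrix g)\<bar>)) (box l u)
      = (\<Prod>b\<in>Basis. (u - l) \<bullet> b)" .
qed simp

lemma
  fixes g :: "(real, 'n::{finite,wellorder}) vec \<Rightarrow> (real, 'n) vec"
    and f :: "(real, 'n) vec \<Rightarrow> 'b::{banach, second_countable_topology}"
  assumes lin: "linear g" and det: "det (matrix g) \<noteq> 0" and f: "f \<in> borel_measurable borel"
  shows integral_lborel_linear:
      "(\<integral>x. f x \<partial>lborel) = \<bar>det (matrix g)\<bar> *\<^sub>R (\<integral>x. f (g x) \<partial>lborel)"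
    and integrable_lborel_linear:
      "integrable lborel f \<Longrightarrow> integrable lborel (\<lambda>x. f (g x))"
proof -
  have [measurable]: "g \<in> borel_measurable borel"
    using lin by (simp add: borel_measurable_continuous_onI linear_continuous_on linear_linear)
  note [measurable] = f
  show "(\<integral>x. f x \<partial>lborel) = \<bar>det (matrix g)\<bar> *\<^sub>R (\<integral>x. f (g x) \<partial>lborel)"
    by (subst lborel_eq_density_distr_linear[OF lin det])
       (simp add: integral_density integral_distr)
  assume "integrable lborel f"
  then have "integrable (density (distr lborel borel g) (\<lambda>_. ennreal \<bar>det (matrix g)\<bar>)) f"
    using lborel_eq_density_distr_linear[OF lin det] by metis
  then have "integrable lborel (\<lambda>x. \<bar>det (matrix g)\<bar> *\<^sub>R f (g x))"
    by (simp add: integrable_density integrable_distr_eq)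
  from integrable_scaleR_right[OF this, of "inverse \<bar>det (matrix g)\<bar>"]
  show "integrable lborel (\<lambda>x. f (g x))"
    using det by simp
qed

text \<open>\<open>K_inv\<close> says that \<open>K\<close> times Lebesgue measure is preserved by
  each \<open>g s\<close>, so the integral of \<open>K x * V (g s x)\<close> does not depend on
  \<open>s\<close>. Integrating over \<open>s\<close> in \<open>{0..S}\<close> yields the factor
  \<open>S\<close>; after exchanging the integrals, the inner one is evaluated by the fundamental
  theorem of calculus. The majorant \<open>H\<close>, uniform in \<open>s\<close>, justifies the
  exchange.\<close>

lemma integral_flow_derivative:
  fixes g :: "real \<Rightarrow> (real, 'n::{finite,wellorder}) vec \<Rightarrow> (real, 'n) vec"
    and K V \<phi> :: "(real, 'n) vec \<Rightarrow> complex"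
  assumes S: "0 \<le> S"
    and lin: "\<And>s. linear (g s)" and det: "\<And>s. det (matrix (g s)) \<noteq> 0"
    and K_inv: "\<And>s x. \<bar>det (matrix (g s))\<bar> *\<^sub>R K (g s x) = K x"
    and g_cont: "continuous_on UNIV (\<lambda>(s, x). g s x)"
    and K[measurable]: "K \<in> borel_measurable borel"
    and V: "continuous_on UNIV V"
    and deriv: "\<And>s x. ((\<lambda>s. \<phi> (g s x)) has_vector_derivative V (g s x)) (at s)"
    and bound: "AE x in lborel. \<forall>s\<in>{0..S}. norm (K x * V (g s x)) \<le> H x"
    and H: "integrable lborel H"
  shows "of_real S * (\<integral>x. K x * V x \<partial>lborel)
    = (\<integral>x. K x * (\<phi> (g S x) - \<phi> (g 0 x)) \<partial>lborel)"
proof -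
  have [measurable]: "V \<in> borel_measurable borel"
    using V by (rule borel_measurable_continuous_onI)
  have g2 [measurable]: "(\<lambda>z. g (fst z) (snd z)) \<in> borel_measurable (lborel \<Otimes>\<^sub>M lborel)"
    using borel_measurable_continuous_onI[OF g_cont]
    by (simp add: case_prod_beta' flip: borel_prod)
  have [measurable]: "g s \<in> borel_measurable borel" for s
    using lin by (simp add: borel_measurable_continuous_onI linear_continuous_on linear_linear)
  define f where "f s x = indicat_real {0..S} s *\<^sub>R (K x * V (g s x))" for s x
  have f_meas [measurable]: "(\<lambda>z. f (fst z) (snd z)) \<in> borel_measurable (lborel \<Otimes>\<^sub>M lborel)"
    unfolding f_def by measurable
  have f_bound: "AE x in lborel. norm (f s x) \<le> norm (indicat_real {0..S} s * H x)" for s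
    using bound
  proof eventually_elim
    case (elim x)
    then show ?case by (auto simp: f_def indicator_def intro: order_trans[OF _ abs_ge_self])
  qed
  have f_int: "integrable lborel (f s)" for s
  proof (rule Bochner_Integration.integrable_bound[OF _ _ f_bound])
    show "integrable lborel (\<lambda>x. indicat_real {0..S} s * H x)" using H by simp
    show "f s \<in> borel_measurable lborel" unfolding f_def by measurable
  qed
  have Kg: "(\<integral>x. K x * V (g s x) \<partial>lborel) = (\<integral>x. K x * V x \<partial>lborel)" for s
  proof -
    have "(\<integral>x. K x * V x \<partial>lborel) = \<bar>det (matrix (g s))\<bar> *\<^sub>R (\<integral>x. K (g s x) * V (g s x) \<partial>lborel)"
      by (rule integral_lborel_linear[OF lin det]) measurable
    also have "\<dots> = (\<integral>x. (\<bar>det (matrix (g s))\<bar> *\<^sub>R K (g s x)) * V (g s x) \<partial>lborel)"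
      by (simp flip: integral_scaleR_right)
    finally show ?thesis by (simp add: K_inv)
  qed
  have "integrable (lborel \<Otimes>\<^sub>M lborel) (\<lambda>z. f (fst z) (snd z))"
  proof (rule lborel_pair.Fubini_integrable)
    show "AE s in lborel. integrable lborel (\<lambda>x. f (fst (s, x)) (snd (s, x)))"
      using f_int by simp
    have "integrable lborel (\<lambda>s. \<integral>x. norm (f s x) \<partial>lborel)"
    proof (rule Bochner_Integration.integrable_bound)
      show "integrable lborel (\<lambda>s. indicat_real {0..S} s * (\<integral>x. norm (H x) \<partial>lborel))"
        using S by (intro integrable_mult_left) auto
      have "(\<lambda>s. \<integral>x. norm (f (fst (s, x)) (snd (s, x))) \<partial>lborel) \<in> borel_measurable lborel"
        by measurable
      then show "(\<lambda>s. \<integral>x. norm (f s x) \<partial>lborel) \<in> borel_measurable lborel" by simp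
      show "AE s in lborel. norm (\<integral>x. norm (f s x) \<partial>lborel)
        \<le> norm (indicat_real {0..S} s * (\<integral>x. norm (H x) \<partial>lborel))"
      proof (rule AE_I2)
        fix s
        have "(\<integral>x. norm (f s x) \<partial>lborel) \<le> (\<integral>x. norm (indicat_real {0..S} s * H x) \<partial>lborel)"
          using f_bound f_int H by (intro integral_mono_AE) auto
        then show "norm (\<integral>x. norm (f s x) \<partial>lborel)
          \<le> norm (indicat_real {0..S} s * (\<integral>x. norm (H x) \<partial>lborel))"
          by (simp add: abs_mult)
      qed
    qed
    then show "integrable lborel (\<lambda>s. \<integral>x. norm (f (fst (s, x)) (snd (s, x))) \<partial>lborel)" by simp
  qed (rule f_meas)
  then have "(\<integral>x. (\<integral>s. f s x \<partial>lborel) \<partial>lborel) = (\<integral>s. (\<integral>x. f s x \<partial>lborel) \<partial>lborel)"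
    by (intro lborel_pair.Fubini_integral) (simp add: case_prod_beta')
  moreover have "(\<integral>x. f s x \<partial>lborel) = indicat_real {0..S} s *\<^sub>R (\<integral>x. K x * V x \<partial>lborel)" for s
    unfolding f_def by (simp add: Kg)
  moreover have "(\<integral>s. f s x \<partial>lborel) = K x * (\<phi> (g S x) - \<phi> (g 0 x))" for x
  proof -
    have "continuous_on {0..S} (\<lambda>s. V (g s x))"
    proof (rule continuous_on_compose2[OF V])
      show "continuous_on {0..S} (\<lambda>s. g s x)"
        using continuous_on_compose2[OF g_cont, of "{0..S}" "\<lambda>s. (s, x)"]
        by (simp add: continuous_on_Pair)
    qed simp
    then have "(\<integral>s. indicat_real {0..S} s *\<^sub>R V (g s x) \<partial>lborel) = \<phi> (g S x) - \<phi> (g 0 x)"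
      using S deriv by (intro integral_FTC_Icc) (auto intro: has_vector_derivative_at_within)
    then show ?thesis unfolding f_def by (simp flip: mult_scaleR_right)
  qed
  ultimately show ?thesis using S by (simp add: scaleR_conv_of_real)
qed

text \<open>Both mixed derivatives are limits of the same double difference quotient.\<close>

lemma mixed_derivatives_eq:
  fixes f fx fy fxy fyx :: "real \<Rightarrow> real \<Rightarrow> real"
  assumes fx: "\<And>s t. ((\<lambda>s. f s t) has_real_derivative fx s t) (at s)"
    and fy: "\<And>s t. ((\<lambda>t. f s t) has_real_derivative fy s t) (at t)"
    and fxy: "\<And>s t. ((\<lambda>t. fx s t) has_real_derivative fxy s t) (at t)"
    and fyx: "\<And>s t. ((\<lambda>s. fy s t) has_real_derivative fyx s t) (at s)"
    and cxy: "isCont (\<lambda>z. fxy (fst z) (snd z)) (0, 0)"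
    and cyx: "isCont (\<lambda>z. fyx (fst z) (snd z)) (0, 0)"
  shows "fxy 0 0 = fyx 0 0"
proof (rule ccontr)
  assume "fxy 0 0 \<noteq> fyx 0 0"
  \<comment> \<open>Half the gap: two equal values cannot lie within \<open>e\<close> of both
    limits.\<close>
  define e where "e = \<bar>fxy 0 0 - fyx 0 0\<bar> / 2"
  have "e > 0" using \<open>fxy 0 0 \<noteq> fyx 0 0\<close> by (simp add: e_def)
  obtain d1 where d1: "d1 > 0" "\<And>z. dist z (0, 0) < d1 \<Longrightarrow> dist (fxy (fst z) (snd z)) (fxy 0 0) < e"
    using cxy \<open>e > 0\<close> by (auto simp: continuous_at_eps_delta)
  obtain d2 where d2: "d2 > 0" "\<And>z. dist z (0, 0) < d2 \<Longrightarrow> dist (fyx (fst z) (snd z)) (fyx 0 0) < e"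
    using cyx \<open>e > 0\<close> by (auto simp: continuous_at_eps_delta)
  \<comment> \<open>In the product metric a point with both coordinates in (0, h) is closer than
    \<open>2 * h\<close> to the origin, hence the halving.\<close>
  define h where "h = min d1 d2 / 2"
  have h: "h > 0" "2 * h \<le> d1" "2 * h \<le> d2" using d1 d2 by (auto simp: h_def)
  have near: "dist (s, t) (0, 0) < 2 * h" if "0 < s" "s < h" "0 < t" "t < h" for s t :: real
    using that norm_Pair_le[of s t] by (simp add: dist_norm)
  obtain a where a: "0 < a" "a < h" "(f h h - f h 0) - (f 0 h - f 0 0) = (h - 0) * (fx a h - fx a 0)"
    using MVT2[of 0 h "\<lambda>s. f s h - f s 0" "\<lambda>s. fx s h - fx s 0"] h DERIV_diff[OF fx fx] by blast
  obtain b where b: "0 < b" "b < h" "fx a h - fx a 0 = (h - 0) * fxy a b"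
    using MVT2[of 0 h "fx a" "fxy a"] h fxy by auto
  obtain c where c: "0 < c" "c < h" "(f h h - f 0 h) - (f h 0 - f 0 0) = (h - 0) * (fy h c - fy 0 c)"
    using MVT2[of 0 h "\<lambda>t. f h t - f 0 t" "\<lambda>t. fy h t - fy 0 t"] h DERIV_diff[OF fy fy] by blast
  obtain d where d: "0 < d" "d < h" "fy h c - fy 0 c = (h - 0) * fyx d c"
    using MVT2[of 0 h "\<lambda>s. fy s c" "\<lambda>s. fyx s c"] h fyx by auto
  have "h * (h * fxy a b) = h * (h * fyx d c)"
    using a b c d by (simp add: algebra_simps)
  then have "fxy a b = fyx d c" using h by simp
  moreover have "dist (fxy a b) (fxy 0 0) < e" using d1(2)[of "(a, b)"] near[of a b] a b h by simp
  moreover have "dist (fyx d c) (fyx 0 0) < e" using d2(2)[of "(d, c)"] near[of d c] c d h by simp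
  ultimately show False using \<open>e > 0\<close> unfolding e_def dist_real_def by (auto simp: abs_if split: if_splits)
qed

subsection \<open>Derivatives of test functions\<close>

lemma partial_eqI:
  assumes "(f has_derivative D) (at x)"
  shows "partial i f x = D (axis i 1)"
proof -
  have lin: "linear D" using assms by (rule has_derivative_linear)
  have "((\<lambda>t. x + t *\<^sub>R axis i 1) has_derivative (\<lambda>t. t *\<^sub>R axis i 1)) (at 0)"
    by (auto intro!: derivative_eq_intros)
  moreover have "(f has_derivative D) (at (x + 0 *\<^sub>R axis i 1))" using assms by simp
  ultimately have "((\<lambda>t. f (x + t *\<^sub>R axis i 1)) has_derivative (\<lambda>t. D (t *\<^sub>R axis i 1))) (at 0)"
    using has_derivative_compose by blast
  then have "((\<lambda>t. f (x + t *\<^sub>R axis i 1)) has_vector_derivative D (axis i 1)) (at 0)"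
    using linear_scale[OF lin] by (simp add: has_vector_derivative_def)
  then show ?thesis unfolding partial_def by (rule vector_derivative_at)
qed

lemma has_derivative_partial:
  assumes "f differentiable (at x)"
  shows "(f has_derivative (\<lambda>h. \<Sum>i\<in>UNIV. h$i *\<^sub>R partial i f x)) (at x)"
proof -
  obtain D where D: "(f has_derivative D) (at x)" using assms by (auto simp: differentiable_def)
  have lin: "linear D" using D by (rule has_derivative_linear)
  have "D h = (\<Sum>i\<in>UNIV. h$i *\<^sub>R partial i f x)" for h
    by (subst basis_expansion[symmetric], subst linear_sum[OF lin])
       (simp add: partial_eqI[OF D] scalar_mult_eq_scaleR linear_scale[OF lin])
  then have "D = (\<lambda>h. \<Sum>i\<in>UNIV. h$i *\<^sub>R partial i f x)" by blast
  with D show ?thesis by simp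
qed

lemma sum_axis: "(\<Sum>j\<in>UNIV. (c *\<^sub>R axis i 1 :: heis)$j *\<^sub>R P j) = c *\<^sub>R P i" for P :: "3 \<Rightarrow> complex"
  by (simp add: axis_def if_distrib[where f="\<lambda>c. _ * c"] if_distrib[where f="\<lambda>c. c *\<^sub>R _"] cong: if_cong)

lemma has_vector_derivative_partial:
  assumes "f differentiable_on UNIV"
  shows "((\<lambda>t. f (x + t *\<^sub>R axis i 1)) has_vector_derivative partial i f (x + t *\<^sub>R axis i 1)) (at t)"
proof -
  let ?y = "x + t *\<^sub>R axis i 1"
  have D: "(f has_derivative (\<lambda>h. \<Sum>i\<in>UNIV. h$i *\<^sub>R partial i f ?y)) (at ?y)"
    using assms by (intro has_derivative_partial) (simp add: differentiable_on_def)
  have "((\<lambda>t. x + t *\<^sub>R axis i 1) has_derivative (\<lambda>t. t *\<^sub>R axis i 1)) (at t)"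
    by (auto intro!: derivative_eq_intros)
  from has_derivative_compose[OF this D]
  have "((\<lambda>t. f (x + t *\<^sub>R axis i 1)) has_derivative
      (\<lambda>s. \<Sum>j\<in>UNIV. (s *\<^sub>R axis i 1 :: heis)$j *\<^sub>R partial j f ?y)) (at t)" .
  then show ?thesis by (simp add: has_vector_derivative_def sum_axis del: vector_scaleR_component)
qed

lemma test_function_differentiable: "test_function \<phi> \<Longrightarrow> \<phi> differentiable (at x)"
  using Ck.simps(2)[of 0 \<phi>] unfolding test_function_def differentiable_on_def by auto

lemma test_function_continuous: "test_function \<phi> \<Longrightarrow> continuous_on UNIV \<phi>"
  using Ck.simps(1)[of \<phi>] unfolding test_function_def by metis

lemma partial_eq_0:
  assumes "x \<notin> closure {x. \<phi> x \<noteq> 0}"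
  shows "partial i \<phi> x = 0"
proof -
  have "((\<lambda>_. 0) has_derivative (\<lambda>_. 0)) (at x)" by simp
  then have "(\<phi> has_derivative (\<lambda>_. 0)) (at x)"
  proof (rule has_derivative_transform_within_open)
    show "open (- closure {x. \<phi> x \<noteq> 0})" using closed_closure by (rule open_Compl)
    show "x \<in> - closure {x. \<phi> x \<noteq> 0}" using assms by simp
    show "0 = \<phi> y" if "y \<in> - closure {x. \<phi> x \<noteq> 0}" for y
      using that closure_subset[of "{x. \<phi> x \<noteq> 0}"] by auto
  qed
  then show ?thesis by (rule partial_eqI)
qed

lemma test_function_partial:
  assumes "test_function \<phi>"
  shows "test_function (partial i \<phi>)"
proof -
  have "Ck k (partial i \<phi>)" for k
    using assms Ck.simps(2)[of k \<phi>] unfolding test_function_def by blast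
  moreover have "closure {x. partial i \<phi> x \<noteq> 0} \<subseteq> closure {x. \<phi> x \<noteq> 0}"
    using partial_eq_0 by (intro closure_minimal) auto
  then have "compact (closure {x. partial i \<phi> x \<noteq> 0})"
    using assms unfolding test_function_def by (metis closed_Int_compact closed_closure inf.absorb1)
  ultimately show ?thesis unfolding test_function_def by simp
qed

lemma test_function_bounded:
  assumes "test_function \<phi>"
  obtains B where "B \<ge> 0" "\<And>x. norm (\<phi> x) \<le> B"
proof -
  let ?K = "closure {x. \<phi> x \<noteq> 0}"
  have "compact (\<phi> ` ?K)"
    using assms test_function_continuous[OF assms] unfolding test_function_def
    by (intro compact_continuous_image) (auto intro: continuous_on_subset)
  then obtain B where B: "\<And>x. x \<in> ?K \<Longrightarrow> norm (\<phi> x) \<le> B"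
    using compact_imp_bounded by (metis bounded_iff imageI)
  have "norm (\<phi> x) \<le> max B 0" for x
    using B[of x] closure_subset[of "{x. \<phi> x \<noteq> 0}"] by (cases "\<phi> x = 0") auto
  then show thesis using that[of "max B 0"] by simp
qed

lemma partial_commute:
  assumes "test_function \<phi>"
  shows "partial i (partial j \<phi>) x = partial j (partial i \<phi>) x"
proof -
  note test = assms test_function_partial[OF assms] test_function_partial[OF test_function_partial[OF assms]]
  have diff: "f differentiable_on UNIV" if "test_function f" for f
    using that test_function_differentiable by (auto simp: differentiable_on_def)
  \<comment> \<open>\<open>L\<close> will be \<open>Re\<close> or \<open>Im\<close>: the mean value
    theorem behind \<open>mixed_derivatives_eq\<close> is available only for real values.\<close>
  have line: "((\<lambda>s. L (f (x + s *\<^sub>R axis i 1 + t *\<^sub>R axis j 1))) has_real_derivative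
        L (partial i f (x + s *\<^sub>R axis i 1 + t *\<^sub>R axis j 1))) (at s)"
    if "test_function f" "bounded_linear L" for f i j s t and L :: "complex \<Rightarrow> real"
    using bounded_linear.has_vector_derivative[OF that(2)
        has_vector_derivative_partial[OF diff[OF that(1)], of "x + t *\<^sub>R axis j 1" i s]]
    by (simp add: has_real_derivative_iff_has_vector_derivative add_ac)
  have line': "((\<lambda>s. L (f (x + t *\<^sub>R axis j 1 + s *\<^sub>R axis i 1))) has_real_derivative
        L (partial i f (x + t *\<^sub>R axis j 1 + s *\<^sub>R axis i 1))) (at s)"
    if "test_function f" "bounded_linear L" for f i j s t and L :: "complex \<Rightarrow> real"
    using line[OF that, of i t j s] by (simp add: add_ac)
  have cont: "isCont (\<lambda>z. L (f (x + fst z *\<^sub>R axis i 1 + snd z *\<^sub>R axis j 1))) (0, 0)"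
    if "test_function f" "bounded_linear L" for f and L :: "complex \<Rightarrow> real"
  proof -
    have "continuous_on UNIV (\<lambda>z. f (x + fst z *\<^sub>R axis i 1 + snd z *\<^sub>R axis j 1))"
      by (rule continuous_on_compose2[OF test_function_continuous[OF that(1)]])
         (auto intro!: continuous_intros)
    then have "continuous_on UNIV (\<lambda>z. L (f (x + fst z *\<^sub>R axis i 1 + snd z *\<^sub>R axis j 1)))"
      using bounded_linear.continuous_on[OF that(2)] by blast
    then show ?thesis by (simp add: continuous_on_eq_continuous_at)
  qed
  have *: "L (partial j (partial i \<phi>) x) = L (partial i (partial j \<phi>) x)"
    if L: "bounded_linear L" for L :: "complex \<Rightarrow> real"
    using mixed_derivatives_eq[OF line[OF test(1) L] line'[OF test(1) L] line'[OF test(2) L]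
        line[OF test(2) L] cont[OF test(3) L] cont[OF test(3) L]] by simp
  show ?thesis
    using *[OF bounded_linear_Re] *[OF bounded_linear_Im] by (simp add: complex_eq_iff)
qed

text \<open>Second-order terms cancel by symmetry of mixed partials, and differentiating the
  coefficients \<open>x$1 / 2\<close> and \<open>- x$2 / 2\<close> leaves two halves of the vertical
  derivative. Continuity and support are recorded because \<open>distr_bracket\<close> unfolds into
  two separate integrals, each of which must converge before they can be merged.\<close>

lemma test_function_X_commutator:
  assumes "test_function \<phi>"
  shows "X1 (X2 \<phi>) x - X2 (X1 \<phi>) x = partial 3 \<phi> x"
    and "continuous_on UNIV (X1 (X2 \<phi>))" "continuous_on UNIV (X2 (X1 \<phi>))"
    and "x \<notin> closure {x. \<phi> x \<noteq> 0} \<Longrightarrow> X1 (X2 \<phi>) x = 0"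
    and "x \<notin> closure {x. \<phi> x \<noteq> 0} \<Longrightarrow> X2 (X1 \<phi>) x = 0"
proof -
  note test = test_function_partial[OF assms]
  note D = has_derivative_partial[OF test_function_differentiable[OF test]]
  have coord: "((\<lambda>x. complex_of_real (x$k / 2)) has_derivative (\<lambda>h. complex_of_real (h$k / 2))) (at x)"
    for k :: 3 and x :: heis
  proof (rule bounded_linear_imp_has_derivative)
    have "linear (\<lambda>h :: heis. complex_of_real (h$k / 2))"
      by (rule linearI) (simp_all add: complex_eq_iff add_divide_distrib)
    then show "bounded_linear (\<lambda>h :: heis. complex_of_real (h$k / 2))"
      by (simp add: linear_conv_bounded_linear)
  qed
  have p2: "partial i (X2 \<phi>) x = partial i (partial 2 \<phi>) x + of_real (x$1 / 2) * partial i (partial 3 \<phi>) x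
      + of_real (axis i 1 $ 1 / 2) * partial 3 \<phi> x" for i x
  proof -
    have "(X2 \<phi> has_derivative (\<lambda>h. (\<Sum>i\<in>UNIV. h$i *\<^sub>R partial i (partial 2 \<phi>) x)
        + (of_real (x$1 / 2) * (\<Sum>i\<in>UNIV. h$i *\<^sub>R partial i (partial 3 \<phi>) x)
         + of_real (h$1 / 2) * partial 3 \<phi> x))) (at x)"
      unfolding X2_def by (intro has_derivative_add has_derivative_mult coord D)
    from partial_eqI[OF this, of i] show ?thesis
      
      using sum_axis[of 1 i] by (simp add: algebra_simps)
  qed
  have p1: "partial i (X1 \<phi>) x = partial i (partial 1 \<phi>) x - of_real (x$2 / 2) * partial i (partial 3 \<phi>) x
      - of_real (axis i 1 $ 2 / 2) * partial 3 \<phi> x" for i x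
  proof -
    have "(X1 \<phi> has_derivative (\<lambda>h. (\<Sum>i\<in>UNIV. h$i *\<^sub>R partial i (partial 1 \<phi>) x)
        - (of_real (x$2 / 2) * (\<Sum>i\<in>UNIV. h$i *\<^sub>R partial i (partial 3 \<phi>) x)
         + of_real (h$2 / 2) * partial 3 \<phi> x))) (at x)"
      unfolding X1_def by (intro has_derivative_diff has_derivative_mult coord D)
    from partial_eqI[OF this, of i] show ?thesis
      
      using sum_axis[of 1 i] by (simp add: algebra_simps)
  qed
  have X12: "X1 (X2 \<phi>) = (\<lambda>x. partial 1 (partial 2 \<phi>) x + of_real (x$1 / 2) * partial 1 (partial 3 \<phi>) x
      + of_real (1/2) * partial 3 \<phi> x
      - of_real (x$2 / 2) * (partial 3 (partial 2 \<phi>) x + of_real (x$1 / 2) * partial 3 (partial 3 \<phi>) x))"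
    by (rule ext) (simp add: X1_def[of "X2 \<phi>"] p2 axis_def)
  have X21: "X2 (X1 \<phi>) = (\<lambda>x. partial 2 (partial 1 \<phi>) x - of_real (x$2 / 2) * partial 2 (partial 3 \<phi>) x
      - of_real (1/2) * partial 3 \<phi> x
      + of_real (x$1 / 2) * (partial 3 (partial 1 \<phi>) x - of_real (x$2 / 2) * partial 3 (partial 3 \<phi>) x))"
    by (rule ext) (simp add: X2_def[of "X1 \<phi>"] p1 axis_def)
  show "X1 (X2 \<phi>) x - X2 (X1 \<phi>) x = partial 3 \<phi> x"
    unfolding X12 X21
    by (simp add: partial_commute[OF assms, of 2 1] partial_commute[OF assms, of 3 1]
        partial_commute[OF assms, of 3 2] algebra_simps)
  note cont = continuous_intros test_function_continuous test test_function_partial[OF test]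
  show "continuous_on UNIV (X1 (X2 \<phi>))" unfolding X12 by (intro cont) simp_all
  show "continuous_on UNIV (X2 (X1 \<phi>))" unfolding X21 by (intro cont) simp_all
  assume x: "x \<notin> closure {x. \<phi> x \<noteq> 0}"
  have "closure {x. partial i \<phi> x \<noteq> 0} \<subseteq> closure {x. \<phi> x \<noteq> 0}" for i
    using partial_eq_0 by (intro closure_minimal) auto
  then have "partial i \<phi> x = 0" "partial j (partial i \<phi>) x = 0" for i j
    using x partial_eq_0 by blast+
  then show "X1 (X2 \<phi>) x = 0" "X2 (X1 \<phi>) x = 0" unfolding X12 X21 by simp_all
qed

lemma locally_integrable_mult:
  assumes f: "locally_integrable f" and K: "compact K"
    and \<psi>: "continuous_on UNIV \<psi>" and supp: "\<And>x. x \<notin> K \<Longrightarrow> \<psi> x = 0"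
  shows "integrable lborel (\<lambda>x. f x * \<psi> x)"
proof -
  have "bounded (\<psi> ` K)"
    using K \<psi> by (intro compact_imp_bounded compact_continuous_image) (auto intro: continuous_on_subset)
  then obtain B where B: "\<And>x. x \<in> K \<Longrightarrow> norm (\<psi> x) \<le> B" by (auto simp: bounded_iff)
  have int: "integrable lborel (\<lambda>x. indicat_real K x *\<^sub>R f x)"
    using f K unfolding locally_integrable_def set_integrable_def by blast
  have eq: "(\<lambda>x. f x * \<psi> x) = (\<lambda>x. (indicat_real K x *\<^sub>R f x) * \<psi> x)"
    using supp by (auto simp: indicator_def fun_eq_iff)
  have [measurable]: "\<psi> \<in> borel_measurable borel" using \<psi> by (rule borel_measurable_continuous_onI)
  note [measurable] = borel_measurable_integrable[OF int, simplified]
  show ?thesis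
    unfolding eq
  proof (rule Bochner_Integration.integrable_bound)
    show "integrable lborel (\<lambda>x. of_real B * (indicat_real K x *\<^sub>R f x))"
      using int by (intro integrable_mult_right)
    show "AE x in lborel. norm ((indicat_real K x *\<^sub>R f x) * \<psi> x) \<le> norm (of_real B * (indicat_real K x *\<^sub>R f x))"
    proof (rule AE_I2)
      fix x
      show "norm ((indicat_real K x *\<^sub>R f x) * \<psi> x) \<le> norm (of_real B * (indicat_real K x *\<^sub>R f x))"
        using B[of x] by (auto simp: indicator_def norm_mult mult.commute[of "norm (f x)"] intro!: mult_right_mono)
    qed
    show "(\<lambda>x. indicat_real K x *\<^sub>R f x * \<psi> x) \<in> borel_measurable lborel" by measurable
  qed
qed

subsection \<open>The horizontal gradient of the candidate solution\<close>

definition rsq :: "heis \<Rightarrow> real" where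
  "rsq x = (x$1)\<^sup>2 + (x$2)\<^sup>2"

text \<open>The square of the Koranyi gauge, homogeneous of degree 2 under the dilations; its square
  root plays the part of the distance to the origin.\<close>

definition gauge_sq :: "heis \<Rightarrow> real" where
  "gauge_sq x = norm (v_fun x)"

lemma vec3_eq_0_iff: "(x :: heis) = 0 \<longleftrightarrow> x$1 = 0 \<and> x$2 = 0 \<and> x$3 = 0"
  by (simp add: vec_eq_iff forall_3)

lemma v_fun_eq_Complex: "v_fun x = Complex (rsq x) (- 4 * x$3)"
  by (simp add: v_fun_def rsq_def complex_eq_iff)

lemma w_fun_eq_Complex: "w_fun x = Complex (rsq x) (4 * x$3)"
  by (simp add: w_fun_def rsq_def complex_eq_iff)

lemma gauge_sq_eq: "gauge_sq x = sqrt ((rsq x)\<^sup>2 + 16 * (x$3)\<^sup>2)"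
  by (simp add: gauge_sq_def v_fun_eq_Complex complex_norm power_mult_distrib)

lemma norm_w_fun: "norm (w_fun x) = gauge_sq x"
  by (simp add: gauge_sq_eq w_fun_eq_Complex complex_norm power_mult_distrib)

lemma gauge_sq_nonneg [simp]: "0 \<le> gauge_sq x"
  by (simp add: gauge_sq_def)

lemma rsq_nonneg [simp]: "0 \<le> rsq x"
  by (simp add: rsq_def)

lemma rsq_le_gauge_sq: "rsq x \<le> gauge_sq x"
  unfolding gauge_sq_eq by (rule real_le_rsqrt) simp

lemma height_le_gauge_sq: "4 * \<bar>x$3\<bar> \<le> gauge_sq x"
  unfolding gauge_sq_eq by (rule real_le_rsqrt) (simp add: power_mult_distrib)

lemma coord_le_gauge_sq:
  "\<bar>x$1\<bar> \<le> sqrt (gauge_sq x)" "\<bar>x$2\<bar> \<le> sqrt (gauge_sq x)"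
  using rsq_le_gauge_sq[of x] unfolding rsq_def
  by (auto intro!: real_le_rsqrt) (smt (verit) zero_le_power2)+

lemma gauge_sq_eq_0_iff: "gauge_sq x = 0 \<longleftrightarrow> x = 0"
  by (auto simp: gauge_sq_def v_fun_eq_Complex complex_eq_iff rsq_def vec3_eq_0_iff sum_power2_eq_zero_iff)

lemma gauge_sq_pos: "x \<noteq> 0 \<Longrightarrow> 0 < gauge_sq x"
  using gauge_sq_eq_0_iff[of x] gauge_sq_nonneg[of x] by linarith

lemma continuous_on_gauge_sq [continuous_intros]: "continuous_on A gauge_sq"
  unfolding gauge_sq_eq rsq_def by (intro continuous_intros)

lemma continuous_on_rsq [continuous_intros]: "continuous_on A rsq"
  unfolding rsq_def by (intro continuous_intros)

text \<open>The real part \<open>rsq x\<close> is nonnegative, and where it vanishes off the origin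
  the value is a nonzero imaginary number. So the principal powers are differentiable on the
  vertical axis as well.\<close>

lemma v_fun_nonpos_Reals: "x \<noteq> 0 \<Longrightarrow> v_fun x \<notin> \<real>\<^sub>\<le>\<^sub>0"
  and w_fun_nonpos_Reals: "x \<noteq> 0 \<Longrightarrow> w_fun x \<notin> \<real>\<^sub>\<le>\<^sub>0"
  using rsq_nonneg[of x]
  by (auto simp: v_fun_eq_Complex w_fun_eq_Complex complex_nonpos_Reals_iff rsq_def vec3_eq_0_iff
      sum_power2_eq_zero_iff sum_power2_le_zero_iff)

lemma v_fun_times_w_fun: "v_fun x * w_fun x = of_real ((gauge_sq x)\<^sup>2)"
  by (simp add: v_fun_eq_Complex w_fun_eq_Complex gauge_sq_eq complex_eq_iff power2_eq_square)

section \<open>Modulus, derivative and weight of the candidate solution\<close>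

lemma norm_powr_of_real: "norm (z powr of_real a) = norm z powr a" for z :: complex
  by (simp add: norm_powr_complex)

lemma norm_u_fun: "norm (u_fun p L x) = gauge_sq x powr (eta p L + tau p L)"
  by (simp add: u_fun_def norm_mult norm_powr_of_real norm_w_fun powr_add flip: gauge_sq_def)

text \<open>Logarithmic differentiation. With \<open>u\<close> pulled out of both terms, the weight
  and \<open>u\<close> later merge into the single factor \<open>flux\<close>.\<close>

lemma u_fun_has_derivative:
  assumes "x \<noteq> 0"
  shows "(u_fun p L has_derivative (\<lambda>h. u_fun p L x *
      (of_real (eta p L) * (of_real (2 * x$1 * h$1 + 2 * x$2 * h$2) - 4 * \<i> * of_real (h$3)) / v_fun x
     + of_real (tau p L) * (of_real (2 * x$1 * h$1 + 2 * x$2 * h$2) + 4 * \<i> * of_real (h$3)) / w_fun x))) (at x)"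
proof -
  have coord: "((\<lambda>x :: heis. x$k) has_derivative (\<lambda>h. h$k)) (at x)" for k
    by (rule bounded_linear_imp_has_derivative) (rule bounded_linear_vec_nth)
  have q: "((\<lambda>x. complex_of_real ((x$1)\<^sup>2 + (x$2)\<^sup>2)) has_derivative
      (\<lambda>h. of_real (2 * x$1 * h$1 + 2 * x$2 * h$2))) (at x)"
    by (rule has_derivative_of_real) (auto intro!: derivative_eq_intros coord)
  have t: "((\<lambda>x :: heis. 4 * \<i> * of_real (x$3)) has_derivative (\<lambda>h. 4 * \<i> * of_real (h$3))) (at x)"
    by (intro has_derivative_mult_right has_derivative_of_real coord)
  have dv: "(v_fun has_derivative (\<lambda>h. of_real (2 * x$1 * h$1 + 2 * x$2 * h$2) - 4 * \<i> * of_real (h$3))) (at x)"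
    unfolding v_fun_def by (intro has_derivative_diff q t)
  have dw: "(w_fun has_derivative (\<lambda>h. of_real (2 * x$1 * h$1 + 2 * x$2 * h$2) + 4 * \<i> * of_real (h$3))) (at x)"
    unfolding w_fun_def by (intro has_derivative_add q t)
  have power: "((\<lambda>x. f x powr a) has_derivative (\<lambda>h. f x powr a * (a * D h / f x))) (at x)"
    if f: "(f has_derivative D) (at x)" and nonpos: "f x \<notin> \<real>\<^sub>\<le>\<^sub>0"
    for f :: "heis \<Rightarrow> complex" and D a
  proof -
    have "f x \<noteq> 0" using nonpos by auto
    then have "f x powr (a - 1) = f x powr a / f x" by (simp add: powr_diff)
    with has_derivative_compose[OF f has_field_derivative_imp_has_derivative[OF has_field_derivative_powr[OF nonpos, of a]]]
    show ?thesis by (simp add: mult_ac)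
  qed
  have "((\<lambda>x. v_fun x powr of_real (eta p L) * w_fun x powr of_real (tau p L)) has_derivative
     (\<lambda>h. v_fun x powr of_real (eta p L) * (w_fun x powr of_real (tau p L) *
        (of_real (tau p L) * (of_real (2 * x$1 * h$1 + 2 * x$2 * h$2) + 4 * \<i> * of_real (h$3)) / w_fun x))
       + v_fun x powr of_real (eta p L) * (of_real (eta p L)
         * (of_real (2 * x$1 * h$1 + 2 * x$2 * h$2) - 4 * \<i> * of_real (h$3)) / v_fun x)
         * w_fun x powr of_real (tau p L))) (at x)"
    using assms
    by (intro has_derivative_mult power v_fun_nonpos_Reals w_fun_nonpos_Reals dv dw)
  then show ?thesis
    unfolding u_fun_def by (rule has_derivative_eq_rhs) (simp add: fun_eq_iff algebra_simps)
qed

text \<open>With \<zeta> = x1 + i x2 and its conjugate \<zeta>', the frame acts by X1 v = 2 \<zeta>,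
  X2 v = -2i \<zeta>, X1 w = 2 \<zeta>', X2 w = 2i \<zeta>'.\<close>

lemma
  assumes "x \<noteq> 0"
  shows X1_u_fun: "X1 (u_fun p L) x = 2 * u_fun p L x *
      (of_real (eta p L) * Complex (x$1) (x$2) / v_fun x + of_real (tau p L) * Complex (x$1) (- x$2) / w_fun x)"
    and X2_u_fun: "X2 (u_fun p L) x = - 2 * \<i> * u_fun p L x *
      (of_real (eta p L) * Complex (x$1) (x$2) / v_fun x - of_real (tau p L) * Complex (x$1) (- x$2) / w_fun x)"
proof -
  have 0: "v_fun x \<noteq> 0" "w_fun x \<noteq> 0" using gauge_sq_pos[OF assms] norm_w_fun[of x] unfolding gauge_sq_def by auto
  have z: "Complex (x$1) (x$2) = of_real (x$1) + \<i> * of_real (x$2)"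
    "Complex (x$1) (- x$2) = of_real (x$1) - \<i> * of_real (x$2)"
    by (simp_all add: complex_eq_iff)
  show "X1 (u_fun p L) x = 2 * u_fun p L x *
      (of_real (eta p L) * Complex (x$1) (x$2) / v_fun x + of_real (tau p L) * Complex (x$1) (- x$2) / w_fun x)"
    using 0 unfolding X1_def partial_eqI[OF u_fun_has_derivative[OF assms]] z
    by (simp add: axis_def field_simps)
  show "X2 (u_fun p L) x = - 2 * \<i> * u_fun p L x *
      (of_real (eta p L) * Complex (x$1) (x$2) / v_fun x - of_real (tau p L) * Complex (x$1) (- x$2) / w_fun x)"
    using 0 unfolding X2_def partial_eqI[OF u_fun_has_derivative[OF assms]] z
    by (simp add: axis_def field_simps)
qed

lemma norm_horizontal_grad_u_fun:
  assumes "x \<noteq> 0"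
  shows "(norm (horizontal_grad (u_fun p L) x))\<^sup>2
    = 8 * ((eta p L)\<^sup>2 + (tau p L)\<^sup>2) * (gauge_sq x powr (2 * (eta p L + tau p L) - 2) * rsq x)"
proof -
  define a where "a = of_real (eta p L) * Complex (x$1) (x$2) / v_fun x"
  define b where "b = of_real (tau p L) * Complex (x$1) (- x$2) / w_fun x"
  have R: "gauge_sq x > 0" using assms by (rule gauge_sq_pos)
  have na: "(norm a)\<^sup>2 = (eta p L)\<^sup>2 * rsq x / (gauge_sq x)\<^sup>2"
    by (simp add: a_def norm_mult norm_divide power_mult_distrib power_divide complex_norm rsq_def
        flip: gauge_sq_def)
  have nb: "(norm b)\<^sup>2 = (tau p L)\<^sup>2 * rsq x / (gauge_sq x)\<^sup>2"
    by (simp add: b_def norm_mult norm_divide power_mult_distrib power_divide complex_norm rsq_def norm_w_fun)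
  have "(norm (horizontal_grad (u_fun p L) x))\<^sup>2 = (norm (2 * u_fun p L x * (a + b)))\<^sup>2
      + (norm (- 2 * \<i> * u_fun p L x * (a - b)))\<^sup>2"
    by (simp add: horizontal_grad_def norm_Pair X1_u_fun[OF assms] X2_u_fun[OF assms] a_def b_def)
  also have "\<dots> = 4 * (norm (u_fun p L x))\<^sup>2 * ((norm (a + b))\<^sup>2 + (norm (a - b))\<^sup>2)"
    by (simp only: norm_mult power_mult_distrib) (simp add: algebra_simps)
  \<comment> \<open>The parallelogram law removes the cross term, so the phases of \<open>a\<close>
    and \<open>b\<close> drop out and the gradient norm depends only on \<open>gauge_sq\<close> and
    \<open>rsq\<close>.\<close>
  also have "(norm (a + b))\<^sup>2 + (norm (a - b))\<^sup>2 = 2 * ((norm a)\<^sup>2 + (norm b)\<^sup>2)"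
    by (simp only: cmod_power2) (simp add: power2_eq_square algebra_simps)
  also have "(norm (u_fun p L x))\<^sup>2 = gauge_sq x powr (2 * (eta p L + tau p L) - 2) * (gauge_sq x)\<^sup>2"
    using R by (simp add: norm_u_fun powr_diff powr_powr algebra_simps flip: powr_numeral)
  finally show ?thesis
    unfolding na nb add_divide_distrib[symmetric] distrib_right[symmetric] using R by simp
qed

text \<open>On the vertical axis the equation still holds: the gradient and \<open>rsq\<close> both
  vanish there, and \<open>0 powr a = 0\<close> for every exponent, negative ones included.\<close>

lemma grad_weight_u_fun:
  assumes "x \<noteq> 0"
  shows "grad_weight p (u_fun p L) x = of_real ((8 * ((eta p L)\<^sup>2 + (tau p L)\<^sup>2)) powr ((p - 2) / 2)
     * gauge_sq x powr ((eta p L + tau p L - 1) * (p - 2)) * rsq x powr ((p - 2) / 2))"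
proof -
  let ?n = "norm (horizontal_grad (u_fun p L) x)"
  have "?n powr (p - 2) = (?n powr 2) powr ((p - 2) / 2)"
    unfolding powr_powr by (simp add: diff_divide_distrib)
  then have "?n powr (p - 2) = (?n\<^sup>2) powr ((p - 2) / 2)" by simp
  also have "\<dots> = (8 * ((eta p L)\<^sup>2 + (tau p L)\<^sup>2)) powr ((p - 2) / 2)
     * (gauge_sq x powr (2 * (eta p L + tau p L) - 2)) powr ((p - 2) / 2) * rsq x powr ((p - 2) / 2)"
    unfolding norm_horizontal_grad_u_fun[OF assms] powr_mult by simp
  also have "(gauge_sq x powr (2 * (eta p L + tau p L) - 2)) powr ((p - 2) / 2)
      = gauge_sq x powr ((eta p L + tau p L - 1) * (p - 2))"
  proof -
    have "(2 * (eta p L + tau p L) - 2) * ((p - 2) / 2) = (eta p L + tau p L - 1) * (p - 2)"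
      by (simp add: right_diff_distrib left_diff_distrib)
    then show ?thesis by (simp only: powr_powr)
  qed
  finally show ?thesis by (simp add: grad_weight_def)
qed

subsection \<open>Local integrability\<close>

lemma integrable_abs_powr_Icc:
  fixes a M :: real
  assumes a: "- 1 < a" and M: "0 \<le> M"
  shows "integrable lborel (\<lambda>y::real. indicat_real {- M..M} y * \<bar>y\<bar> powr a)"
proof -
  let ?f = "\<lambda>y::real. indicat_real {0..M} y * y powr a"
  have "(\<lambda>y. y powr a) absolutely_integrable_on {0..M}"
    using a M by (intro nonnegative_absolutely_integrable_1 integrable_on_powr_from_0) auto
  then have "integrable lebesgue ?f" unfolding set_integrable_def by simp
  moreover have [measurable]: "?f \<in> borel_measurable borel" by measurable
  ultimately have f: "integrable lborel ?f" by (subst (asm) integrable_completion) simp_all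
  have "integrable lborel (\<lambda>y. ?f (0 + (- 1) * y))"
    by (rule lborel_integrable_real_affine[OF f]) simp
  with f have "integrable lborel (\<lambda>y. ?f y + ?f (0 + (- 1) * y))"
    by (rule Bochner_Integration.integrable_add)
  \<comment> \<open>Both halves contain \<open>y = 0\<close>, where \<open>0 powr a = 0\<close>
    prevents double counting.\<close>
  moreover have "(\<lambda>y. ?f y + ?f (0 + (- 1) * y)) = (\<lambda>y. indicat_real {- M..M} y * \<bar>y\<bar> powr a)"
    using M by (auto simp: fun_eq_iff indicator_def)
  ultimately show ?thesis by metis
qed

lemma integrable_prod_vec:
  fixes h :: "real \<Rightarrow> real"
  assumes h: "integrable lborel h" and nonneg: "\<And>y. 0 \<le> h y"
  shows "integrable lborel (\<lambda>x :: real^'n. \<Prod>i\<in>UNIV. h (x$i))"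
proof (rule integrableI_nonneg)
  have [measurable]: "h \<in> borel_measurable borel" using borel_measurable_integrable[OF h] by simp
  show "(\<lambda>x :: real^'n. \<Prod>i\<in>UNIV. h (x$i)) \<in> borel_measurable lborel" by measurable
  show "AE x :: real^'n in lborel. 0 \<le> (\<Prod>i\<in>UNIV. h (x$i))"
    using nonneg by (simp add: prod_nonneg)
  have inj: "inj (\<lambda>i::'n. axis i (1::real))" by (simp add: inj_def axis_eq_axis)
  have Basis: "(Basis :: (real^'n) set) = range (\<lambda>i. axis i 1)" by (auto simp: Basis_vec_def)
  have "ennreal (\<Prod>i\<in>UNIV. h (x$i)) = (\<Prod>b\<in>Basis. ennreal (h (x \<bullet> b)))" for x :: "real^'n"
    unfolding Basis using nonneg by (simp add: prod.reindex[OF inj] inner_axis prod_ennreal)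
  then have "(\<integral>\<^sup>+ x. ennreal (\<Prod>i\<in>UNIV. h (x$i)) \<partial>(lborel :: (real^'n) measure))
      = (\<integral>\<^sup>+ x. (\<Prod>b\<in>Basis. ennreal (h (x \<bullet> b))) \<partial>(lborel :: (real^'n) measure))" by simp
  also have "\<dots> = (\<Prod>b\<in>(Basis :: (real^'n) set). \<integral>\<^sup>+ y. ennreal (h y) \<partial>lborel)"
    by (rule nn_integral_lborel_prod) simp_all
  also have "\<dots> < \<infinity>"
    using h nonneg by (simp add: nn_integral_eq_integral ennreal_power less_top)
  finally show "(\<integral>\<^sup>+ x. ennreal (\<Prod>i\<in>UNIV. h (x$i)) \<partial>(lborel :: (real^'n) measure)) < \<infinity>" .
qed

lemma AE_lborel_vec_nth_neq_0: "AE x in lborel. (x :: real^'n)$i \<noteq> 0"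
proof -
  have "negligible {x :: real^'n. x \<bullet> axis i 1 = 0}"
    by (rule negligible_standard_hyperplane) (simp add: axis_in_Basis_iff)
  then have "{x :: real^'n. x$i = 0} \<in> null_sets lebesgue"
    by (simp add: negligible_iff_null_sets inner_axis)
  moreover have "{x :: real^'n. x$i = 0} \<in> sets lborel" by measurable
  ultimately have "{x :: real^'n. x$i = 0} \<in> null_sets lborel"
    by (metis null_sets_completion_iff)
  then show ?thesis by (rule AE_I') auto
qed

text \<open>Bounds the weighted gradient of \<open>u\<close> up to a constant, and equals the
  modulus of \<open>flux\<close> divided by \<open>sqrt (gauge_sq x)\<close> up to a constant off
  the origin. One degree above the critical -4, it can serve as common majorant.\<close>

definition omega :: "real \<Rightarrow> heis \<Rightarrow> real" where
  "omega p x = gauge_sq x powr (- (p + 1) / 2) * rsq x powr ((p - 2) / 2)"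

lemma omega_nonneg [simp]: "0 \<le> omega p x"
  by (simp add: omega_def)

text \<open>The gauge dominates each of \<open>\<bar>x$3\<bar>\<close> and \<open>\<bar>x$1\<bar> * \<bar>x$2\<bar>\<close>, and the homogeneous degree \<open>- 3\<close>
  of \<open>omega\<close> can be distributed so that every coordinate receives the same integrable power.\<close>

lemma omega_le_prod:
  assumes p: "1 < p" and x: "\<And>i. x$i \<noteq> 0"
  shows "omega p x \<le> (\<Prod>i\<in>UNIV. \<bar>x$i\<bar> powr (- 3 / 4))"
proof -
  have xpos: "0 < \<bar>x$i\<bar>" for i using x[of i] by simp
  have q: "\<bar>x$1\<bar> * \<bar>x$2\<bar> \<le> rsq x"
    using sum_squares_bound[of "\<bar>x$1\<bar>" "\<bar>x$2\<bar>"] mult_nonneg_nonneg[of "\<bar>x$1\<bar>" "\<bar>x$2\<bar>"]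
    unfolding rsq_def power2_abs mult.assoc by linarith
  have qpos: "0 < rsq x" using q mult_pos_pos[OF xpos[of 1] xpos[of 2]] by linarith
  have R: "\<bar>x$3\<bar> \<le> gauge_sq x" using height_le_gauge_sq[of x] by simp
  \<comment> \<open>The coordinates have weights 1, 1, 2, so a common exponent \<open>a\<close> must
    satisfy 4 a = -3, and -3/4 > -1 is integrable. The part -3/4 is spent on \<open>x$3\<close>; the
    rest goes to \<open>rsq\<close>, where it adds up to -3/4 again.\<close>
  have "omega p x = gauge_sq x powr (- 3 / 4) * gauge_sq x powr (- (2 * p - 1) / 4) * rsq x powr ((p - 2) / 2)"
  proof -
    have e: "- (p + 1) / 2 = - 3 / 4 + - (2 * p - 1) / 4" by argo
    have "gauge_sq x powr (- (p + 1) / 2) = gauge_sq x powr (- 3 / 4) * gauge_sq x powr (- (2 * p - 1) / 4)"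
      unfolding e by (rule powr_add)
    then show ?thesis unfolding omega_def by (rule arg_cong[where f="\<lambda>r. r * _"])
  qed
  also have "\<dots> \<le> \<bar>x$3\<bar> powr (- 3 / 4) * rsq x powr (- (2 * p - 1) / 4) * rsq x powr ((p - 2) / 2)"
    using p R qpos xpos[of 3] rsq_le_gauge_sq[of x]
    by (intro mult_mono mult_right_mono powr_mono2') auto
  also have "\<dots> = \<bar>x$3\<bar> powr (- 3 / 4) * rsq x powr (- 3 / 4)"
  proof -
    have e: "- (2 * p - 1) / 4 + (p - 2) / 2 = - 3 / 4" by argo
    show ?thesis unfolding mult.assoc powr_add[symmetric] e ..
  qed
  also have "\<dots> \<le> \<bar>x$3\<bar> powr (- 3 / 4) * (\<bar>x$1\<bar> * \<bar>x$2\<bar>) powr (- 3 / 4)"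
    using q mult_pos_pos[OF xpos[of 1] xpos[of 2]] by (intro mult_left_mono powr_mono2') auto
  also have "\<dots> = (\<Prod>i\<in>UNIV. \<bar>x$i\<bar> powr (- 3 / 4))"
    unfolding powr_mult UNIV_3 by (subst prod.insert; simp)+
  finally show ?thesis .
qed

lemma borel_measurable_gauge_sq [measurable]: "gauge_sq \<in> borel_measurable borel"
  by (intro borel_measurable_continuous_onI continuous_intros)

lemma borel_measurable_rsq [measurable]: "rsq \<in> borel_measurable borel"
  by (intro borel_measurable_continuous_onI continuous_intros)

lemma borel_measurable_omega [measurable]: "omega p \<in> borel_measurable borel"
  unfolding omega_def by measurable

lemma integrable_omega:
  assumes p: "1 < p"
  shows "integrable lborel (\<lambda>x. indicat_real {x. gauge_sq x \<le> M} x * omega p x)"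
proof -
  \<comment> \<open>With \<open>m\<close> at least 1 and at least the gauge square,
    \<open>sqrt (gauge_sq x)\<close> is also at most \<open>m\<close>, so one cube contains all
    three coordinates.\<close>
  define m where "m = max M 1"
  let ?h = "\<lambda>y::real. indicat_real {- m..m} y * \<bar>y\<bar> powr (- 3 / 4)"
  have "integrable lborel (\<lambda>x :: heis. \<Prod>i\<in>UNIV. ?h (x$i))"
    by (intro integrable_prod_vec integrable_abs_powr_Icc) (auto simp: m_def)
  then show ?thesis
  proof (rule Bochner_Integration.integrable_bound)
    show "(\<lambda>x. indicat_real {x. gauge_sq x \<le> M} x * omega p x) \<in> borel_measurable lborel"
      by measurable
    have ae: "AE x in lborel. (x :: heis)$1 \<noteq> 0 \<and> x$2 \<noteq> 0 \<and> x$3 \<noteq> 0"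
      using AE_lborel_vec_nth_neq_0[of 1] AE_lborel_vec_nth_neq_0[of 2] AE_lborel_vec_nth_neq_0[of 3]
      by auto
    then show "AE x in lborel. norm (indicat_real {x. gauge_sq x \<le> M} x * omega p x)
        \<le> norm (\<Prod>i\<in>UNIV. ?h (x$i))"
    proof eventually_elim
      case (elim x)
      then have x: "x$i \<noteq> 0" for i using exhaust_3[of i] by auto
      show ?case
      proof (cases "gauge_sq x \<le> M")
        case True
        have m: "1 \<le> m" "gauge_sq x \<le> m" using True by (auto simp: m_def)
        have "m * 1 \<le> m * m" using m by (intro mult_left_mono) linarith+
        then have "gauge_sq x \<le> m\<^sup>2" using m unfolding power2_eq_square by linarith
        then have "sqrt (gauge_sq x) \<le> m" using m by (intro real_le_lsqrt) linarith+
        then have "x$i \<in> {- m..m}" for i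
          using exhaust_3[of i] coord_le_gauge_sq[of x] height_le_gauge_sq[of x] True
          by (auto simp: m_def abs_le_iff)
        then have "(\<Prod>i\<in>UNIV. ?h (x$i)) = (\<Prod>i\<in>UNIV. \<bar>x$i\<bar> powr (- 3 / 4))" by simp
        with omega_le_prod[OF p x] True show ?thesis by (simp add: prod_nonneg)
      qed simp
    qed
  qed
qed

text \<open>The bound is asked only off the origin, a null set at which the frame derivatives of
  \<open>u\<close> are not controlled.\<close>

lemma integrable_bound_omega:
  fixes f :: "heis \<Rightarrow> complex"
  assumes p: "1 < p" and f: "f \<in> borel_measurable borel"
    and bound: "\<And>x. x \<noteq> 0 \<Longrightarrow> norm (f x) \<le> C * (indicat_real {x. gauge_sq x \<le> M} x * omega p x)"
  shows "integrable lborel f"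
proof (rule Bochner_Integration.integrable_bound)
  show "integrable lborel (\<lambda>x. C * (indicat_real {x. gauge_sq x \<le> M} x * omega p x))"
    using integrable_omega[OF p] by (rule integrable_mult_right)
  have "AE x in lborel. (x :: heis) \<noteq> 0"
    using AE_lborel_vec_nth_neq_0[of 1] by eventually_elim auto
  then show "AE x in lborel. norm (f x) \<le> norm (C * (indicat_real {x. gauge_sq x \<le> M} x * omega p x))"
  proof eventually_elim
    case (elim x)
    have "C * (indicat_real {x. gauge_sq x \<le> M} x * omega p x)
        \<le> norm (C * (indicat_real {x. gauge_sq x \<le> M} x * omega p x))"
      unfolding real_norm_def by (rule abs_ge_self)
    with bound[OF elim] show ?case by (rule order_trans)
  qed
  show "f \<in> borel_measurable lborel" using f by simp
qed

subsection \<open>Decomposition into dilation and rotation fields\<close>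

definition dil_field :: "(heis \<Rightarrow> complex) \<Rightarrow> heis \<Rightarrow> complex" where
  "dil_field \<phi> x = of_real (x$1) * partial 1 \<phi> x + of_real (x$2) * partial 2 \<phi> x
    + 2 * of_real (x$3) * partial 3 \<phi> x"

definition rot_field :: "(heis \<Rightarrow> complex) \<Rightarrow> heis \<Rightarrow> complex" where
  "rot_field \<phi> x = of_real (x$1) * partial 2 \<phi> x - of_real (x$2) * partial 1 \<phi> x"

text \<open>The closed form of the weight times \<open>u\<close> off the origin. Taking the formula
  as definition makes its scaling law valid at every point, as
  \<open>integral_flow_derivative\<close> demands of a density.\<close>

definition flux :: "real \<Rightarrow> real \<Rightarrow> heis \<Rightarrow> complex" where
  "flux p L x = of_real ((8 * ((eta p L)\<^sup>2 + (tau p L)\<^sup>2)) powr ((p - 2) / 2)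
     * gauge_sq x powr ((eta p L + tau p L - 1) * (p - 2)) * rsq x powr ((p - 2) / 2)) * u_fun p L x"

text \<open>This is \<open>2 * flux\<close> times (\<eta>/v + \<tau>/w), over the common denominator
  v w = \<open>(gauge_sq x)\<^sup>2\<close>; \<open>rot_density\<close> is -2i \<open>flux\<close>
  times (\<eta>/v - \<tau>/w).\<close>

definition dil_density :: "real \<Rightarrow> real \<Rightarrow> heis \<Rightarrow> complex" where
  "dil_density p L x = 2 * flux p L x *
     (of_real ((eta p L + tau p L) * rsq x) + 4 * \<i> * of_real ((eta p L - tau p L) * x$3)) / of_real ((gauge_sq x)\<^sup>2)"

definition rot_density :: "real \<Rightarrow> real \<Rightarrow> heis \<Rightarrow> complex" where
  "rot_density p L x = - 2 * \<i> * flux p L x *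
     (of_real ((eta p L - tau p L) * rsq x) + 4 * \<i> * of_real ((eta p L + tau p L) * x$3)) / of_real ((gauge_sq x)\<^sup>2)"

lemma eta_minus_tau: "p \<noteq> 1 \<Longrightarrow> eta p L - tau p L = L"
  by (simp add: eta_def tau_def divide_simps)

lemma eta_plus_tau: "p \<noteq> 1 \<Longrightarrow> (eta p L + tau p L) * (p - 1) = (p - 4) / 2"
  by (simp add: eta_def tau_def divide_simps) (simp add: algebra_simps)

lemma flux_eq: "x \<noteq> 0 \<Longrightarrow> grad_weight p (u_fun p L) x * u_fun p L x = flux p L x"
  by (simp add: grad_weight_u_fun flux_def)

lemma norm_flux:
  assumes p: "1 < p"
  shows "norm (flux p L x)
    = (8 * ((eta p L)\<^sup>2 + (tau p L)\<^sup>2)) powr ((p - 2) / 2) * (sqrt (gauge_sq x) * omega p x)"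
proof -
  have e: "(eta p L + tau p L - 1) * (p - 2) + (eta p L + tau p L) = 1 / 2 + - (p + 1) / 2"
    using eta_plus_tau[of p L] p by (simp add: algebra_simps add_divide_distrib diff_divide_distrib)
  have "gauge_sq x powr ((eta p L + tau p L - 1) * (p - 2)) * gauge_sq x powr (eta p L + tau p L)
      = sqrt (gauge_sq x) * gauge_sq x powr (- (p + 1) / 2)"
    unfolding powr_half_sqrt[OF gauge_sq_nonneg, symmetric] powr_add[symmetric] e ..
  then show ?thesis
    unfolding flux_def omega_def norm_mult norm_u_fun norm_of_real abs_mult
    by (simp add: mult_ac)
qed

lemma norm_density_le:
  fixes a b :: real
  assumes "x \<noteq> 0"
  shows "norm ((of_real (a * rsq x) + 4 * \<i> * of_real (b * x$3)) / of_real ((gauge_sq x)\<^sup>2))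
    \<le> (\<bar>a\<bar> + \<bar>b\<bar>) / gauge_sq x"
proof -
  have R: "0 < gauge_sq x" using assms by (rule gauge_sq_pos)
  have "norm (of_real (a * rsq x) + 4 * \<i> * of_real (b * x$3)) \<le> \<bar>a\<bar> * rsq x + \<bar>b\<bar> * (4 * \<bar>x$3\<bar>)"
    by (rule norm_triangle_le) (simp add: norm_mult abs_mult)
  also have "\<dots> \<le> \<bar>a\<bar> * gauge_sq x + \<bar>b\<bar> * gauge_sq x"
    by (intro add_mono mult_left_mono rsq_le_gauge_sq height_le_gauge_sq) auto
  finally have "norm (of_real (a * rsq x) + 4 * \<i> * of_real (b * x$3)) \<le> (\<bar>a\<bar> + \<bar>b\<bar>) * gauge_sq x"
    by (simp add: distrib_right)
  then have "norm (of_real (a * rsq x) + 4 * \<i> * of_real (b * x$3)) / (gauge_sq x)\<^sup>2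
      \<le> (\<bar>a\<bar> + \<bar>b\<bar>) * gauge_sq x / (gauge_sq x)\<^sup>2"
    by (rule divide_right_mono) simp
  then show ?thesis using R by (simp add: norm_divide norm_power) (simp add: power2_eq_square)
qed

text \<open>The densities have degree -4; multiplying by the gauge raises this to -3, the degree of
  \<open>omega\<close>. The test-function factor will have to supply that gauge.\<close>

lemma density_bound:
  assumes p: "1 < p"
  obtains C where "0 \<le> C" "\<And>x. norm (dil_density p L x) * sqrt (gauge_sq x) \<le> C * omega p x"
    "\<And>x. norm (rot_density p L x) * sqrt (gauge_sq x) \<le> C * omega p x"
proof -
  define c where "c = (8 * ((eta p L)\<^sup>2 + (tau p L)\<^sup>2)) powr ((p - 2) / 2)"
  define C where "C = 2 * c * (\<bar>eta p L + tau p L\<bar> + \<bar>eta p L - tau p L\<bar>)"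
  have c: "0 \<le> c" by (simp add: c_def)
  have *: "2 * norm (flux p L x) * D * sqrt (gauge_sq x) \<le> C * omega p x"
    if D: "D \<le> (\<bar>eta p L + tau p L\<bar> + \<bar>eta p L - tau p L\<bar>) / gauge_sq x" and x: "x \<noteq> 0" for D x
  proof -
    have R: "0 < gauge_sq x" using x by (rule gauge_sq_pos)
    have "2 * norm (flux p L x) * D * sqrt (gauge_sq x)
      \<le> 2 * norm (flux p L x) * ((\<bar>eta p L + tau p L\<bar> + \<bar>eta p L - tau p L\<bar>) / gauge_sq x) * sqrt (gauge_sq x)"
      using D by (intro mult_left_mono mult_right_mono) auto
    also have "\<dots> = C * omega p x * (sqrt (gauge_sq x) * sqrt (gauge_sq x) / gauge_sq x)"
      unfolding norm_flux[OF p] c_def[symmetric] C_def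
      by (simp only: mult_ac times_divide_eq_right times_divide_eq_left)
    also have "\<dots> = C * omega p x" using R by simp
    finally show ?thesis .
  qed
  have "norm (dil_density p L x) * sqrt (gauge_sq x) \<le> C * omega p x" for x
  proof (cases "x = 0")
    case False
    from *[OF norm_density_le[OF this, of "eta p L + tau p L" "eta p L - tau p L"] this]
    show ?thesis unfolding dil_density_def times_divide_eq_right[symmetric] norm_mult by simp
  qed (use gauge_sq_eq_0_iff[of 0] c in \<open>simp add: C_def\<close>)
  moreover have "norm (rot_density p L x) * sqrt (gauge_sq x) \<le> C * omega p x" for x
  proof (cases "x = 0")
    case False
    have "\<bar>eta p L - tau p L\<bar> + \<bar>eta p L + tau p L\<bar> = \<bar>eta p L + tau p L\<bar> + \<bar>eta p L - tau p L\<bar>" by simp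
    from *[OF norm_density_le[OF False, of "eta p L - tau p L" "eta p L + tau p L", unfolded this] False]
    show ?thesis unfolding rot_density_def times_divide_eq_right[symmetric] norm_mult by simp
  qed (use gauge_sq_eq_0_iff[of 0] c in \<open>simp add: C_def\<close>)
  moreover have "0 \<le> C" using c by (simp add: C_def)
  ultimately show thesis using that by blast
qed

text \<open>Put \<zeta> = x + J y with conjugate \<zeta>'. Then \<zeta> (X1 - J X2) = D - J \<Theta>
  - (J/2) v d3 and \<zeta>' (X1 + J X2) = D + J \<Theta> + (J/2) w d3. Multiplied by 2e/v and 2t/w,
  the vertical remainders become -J e d3 and J t d3, which cancel against J (e - t) d3. An abstract
  \<open>J\<close> with \<open>J * J = - 1\<close> turns the claim into polynomial algebra.\<close>

lemma divergence_form_algebra: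
  fixes e t q x y z d1 d2 d3 J :: "'a::field_char_0"
  assumes J: "J * J = - 1" and q: "q = x * x + y * y"
    and v: "v = q - 4 * J * z" "v \<noteq> 0" and w: "w = q + 4 * J * z" "w \<noteq> 0"
  shows "2 * (e * (x + J * y) / v + t * (x - J * y) / w) * (d1 - y / 2 * d3)
     + (- 2 * J) * (e * (x + J * y) / v - t * (x - J * y) / w) * (d2 + x / 2 * d3) + J * (e - t) * d3
   = 2 * ((e + t) * q + 4 * J * ((e - t) * z)) / (v * w) * (x * d1 + y * d2 + 2 * z * d3)
     + (- 2 * J) * ((e - t) * q + 4 * J * ((e + t) * z)) / (v * w) * (x * d2 - y * d1)"
proof -
  \<comment> \<open>Multiplying by \<open>v * w\<close> and by 2 clears all denominators, including
    the halves in the frame; the 2 is cancelled again below.\<close>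
  have "2 * (2 * (e * (x + J * y) * w + t * (x - J * y) * v) * (d1 - y / 2 * d3)
     + (- 2 * J) * (e * (x + J * y) * w - t * (x - J * y) * v) * (d2 + x / 2 * d3) + J * (e - t) * d3 * (v * w))
     = 2 * (e * (x + J * y) * w + t * (x - J * y) * v) * (2 * d1 - y * d3)
     + (- 2 * J) * (e * (x + J * y) * w - t * (x - J * y) * v) * (2 * d2 + x * d3) + 2 * J * (e - t) * d3 * (v * w)"
    by (simp add: algebra_simps)
  also have "\<dots> = 2 * (2 * ((e + t) * q + 4 * J * ((e - t) * z)) * (x * d1 + y * d2 + 2 * z * d3)
     + (- 2 * J) * ((e - t) * q + 4 * J * ((e + t) * z)) * (x * d2 - y * d1))"
    using J unfolding v w q by algebra
  finally have *: "2 * (e * (x + J * y) * w + t * (x - J * y) * v) * (d1 - y / 2 * d3)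
     + (- 2 * J) * (e * (x + J * y) * w - t * (x - J * y) * v) * (d2 + x / 2 * d3) + J * (e - t) * d3 * (v * w)
    = 2 * ((e + t) * q + 4 * J * ((e - t) * z)) * (x * d1 + y * d2 + 2 * z * d3)
     + (- 2 * J) * ((e - t) * q + 4 * J * ((e + t) * z)) * (x * d2 - y * d1)"
    by (rule mult_left_cancel[THEN iffD1, rotated]) simp
  have f1: "e * (x + J * y) / v + t * (x - J * y) / w = (e * (x + J * y) * w + t * (x - J * y) * v) / (v * w)"
    "e * (x + J * y) / v - t * (x - J * y) / w = (e * (x + J * y) * w - t * (x - J * y) * v) / (v * w)"
    using v(2) w(2) by (simp_all add: add_frac_eq diff_frac_eq)
  have f2: "J * (e - t) * d3 = (J * (e - t) * d3 * (v * w)) / (v * w)"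
    using v(2) w(2) by simp
  show ?thesis
    unfolding f1 by (subst f2)
      (simp only: times_divide_eq_right times_divide_eq_left add_divide_distrib[symmetric]
        *[unfolded times_divide_eq_left])
qed

lemma divergence_form:
  assumes p: "p \<noteq> 1" and x: "x \<noteq> 0"
  shows "grad_weight p (u_fun p L) x * X1 (u_fun p L) x * X1 \<phi> x
       + grad_weight p (u_fun p L) x * X2 (u_fun p L) x * X2 \<phi> x
       + \<i> * of_real L * (grad_weight p (u_fun p L) x * u_fun p L x * partial 3 \<phi> x)
     = dil_density p L x * dil_field \<phi> x + rot_density p L x * rot_field \<phi> x"
proof -
  have v: "v_fun x = of_real (rsq x) - 4 * \<i> * of_real (x$3)"
    and w: "w_fun x = of_real (rsq x) + 4 * \<i> * of_real (x$3)"
    by (simp_all add: v_fun_def w_fun_def rsq_def)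
  have 0: "v_fun x \<noteq> 0" "w_fun x \<noteq> 0"
    using gauge_sq_pos[OF x] norm_w_fun[of x] unfolding gauge_sq_def by auto
  have q: "complex_of_real (rsq x) = of_real (x$1) * of_real (x$1) + of_real (x$2) * of_real (x$2)"
    by (simp add: rsq_def power2_eq_square)
  have L: "complex_of_real L = of_real (eta p L) - of_real (tau p L)"
    using eta_minus_tau[OF p, of L] by (metis of_real_diff)
  have z: "Complex (x$1) (x$2) = of_real (x$1) + \<i> * of_real (x$2)"
    "Complex (x$1) (- x$2) = of_real (x$1) - \<i> * of_real (x$2)"
    by (simp_all add: complex_eq_iff)
  have weight: "grad_weight p (u_fun p L) x * (u_fun p L x * a) = flux p L x * a" for a
    using flux_eq[OF x] by (simp flip: mult.assoc)
  let ?E = "complex_of_real (eta p L)" and ?T = "complex_of_real (tau p L)"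
  let ?x = "complex_of_real (x$1)" and ?y = "complex_of_real (x$2)" and ?z = "complex_of_real (x$3)"
  have "grad_weight p (u_fun p L) x * X1 (u_fun p L) x * X1 \<phi> x
       + grad_weight p (u_fun p L) x * X2 (u_fun p L) x * X2 \<phi> x
       + \<i> * of_real L * (grad_weight p (u_fun p L) x * u_fun p L x * partial 3 \<phi> x)
     = flux p L x *
       (2 * (?E * (?x + \<i> * ?y) / v_fun x + ?T * (?x - \<i> * ?y) / w_fun x)
          * (partial 1 \<phi> x - ?y / 2 * partial 3 \<phi> x)
     + (- 2 * \<i>) * (?E * (?x + \<i> * ?y) / v_fun x - ?T * (?x - \<i> * ?y) / w_fun x)
          * (partial 2 \<phi> x + ?x / 2 * partial 3 \<phi> x) + \<i> * (?E - ?T) * partial 3 \<phi> x)"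
    unfolding X1_u_fun[OF x] X2_u_fun[OF x] X1_def[of \<phi>] X2_def[of \<phi>] z L flux_eq[OF x, symmetric]
    by (simp add: algebra_simps)
  also have "\<dots> = flux p L x *
      (2 * ((?E + ?T) * of_real (rsq x) + 4 * \<i> * ((?E - ?T) * ?z)) / (v_fun x * w_fun x)
        * (?x * partial 1 \<phi> x + ?y * partial 2 \<phi> x + 2 * ?z * partial 3 \<phi> x)
     + (- 2 * \<i>) * ((?E - ?T) * of_real (rsq x) + 4 * \<i> * ((?E + ?T) * ?z)) / (v_fun x * w_fun x)
        * (?x * partial 2 \<phi> x - ?y * partial 1 \<phi> x))"
    by (subst divergence_form_algebra[OF _ q v 0(1) w 0(2)]) simp_all
  also have "\<dots> = dil_density p L x * dil_field \<phi> x + rot_density p L x * rot_field \<phi> x"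
  proof -
    have "f * (2 * a / g * d + (- 2 * \<i>) * b / g * d') = 2 * f * a / g * d + - 2 * \<i> * f * b / g * d'"
      for f a b d d' g :: complex by (simp add: algebra_simps)
    then show ?thesis
      unfolding v_fun_times_w_fun dil_density_def rot_density_def dil_field_def rot_field_def
        of_real_mult of_real_add of_real_diff by blast
  qed
  finally show ?thesis .
qed

section \<open>Measurability and local integrability of the weighted terms\<close>

lemma continuous_on_u_fun: "continuous_on (- {0}) (u_fun p L)"
  using u_fun_has_derivative by (intro continuous_at_imp_continuous_on) (auto intro: has_derivative_continuous)

lemma borel_measurable_u_fun [measurable]: "u_fun p L \<in> borel_measurable borel"
  by (rule borel_measurable_continuous_countable_exceptions[OF _ continuous_on_u_fun]) simp

text \<open>The explicit formulas give continuity off the origin, and one exceptional point does not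
  affect Borel measurability.\<close>

lemma
  shows borel_measurable_X1_u_fun [measurable]: "X1 (u_fun p L) \<in> borel_measurable borel"
    and borel_measurable_X2_u_fun [measurable]: "X2 (u_fun p L) \<in> borel_measurable borel"
proof -
  have 0: "v_fun x \<noteq> 0 \<and> w_fun x \<noteq> 0" if "x \<noteq> 0" for x
    using gauge_sq_pos[OF that] norm_w_fun[of x] unfolding gauge_sq_def by auto
  have cont: "continuous_on (- {0}) v_fun" "continuous_on (- {0}) w_fun"
    unfolding v_fun_def w_fun_def by (intro continuous_intros)+
  have z: "Complex (x$1) (x$2) = of_real (x$1) + \<i> * of_real (x$2)"
    "Complex (x$1) (- x$2) = of_real (x$1) - \<i> * of_real (x$2)" for x :: heis
    by (simp_all add: complex_eq_iff)
  have "continuous_on (- {0}) (\<lambda>x. 2 * u_fun p L x *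
      (of_real (eta p L) * Complex (x$1) (x$2) / v_fun x + of_real (tau p L) * Complex (x$1) (- x$2) / w_fun x))"
    unfolding z using 0 by (intro continuous_intros continuous_on_u_fun cont) auto
  then have "continuous_on (- {0}) (X1 (u_fun p L))"
    by (rule continuous_on_eq) (simp add: X1_u_fun)
  then show "X1 (u_fun p L) \<in> borel_measurable borel"
    by (rule borel_measurable_continuous_countable_exceptions[rotated]) simp
  have "continuous_on (- {0}) (\<lambda>x. - 2 * \<i> * u_fun p L x *
      (of_real (eta p L) * Complex (x$1) (x$2) / v_fun x - of_real (tau p L) * Complex (x$1) (- x$2) / w_fun x))"
    unfolding z using 0 by (intro continuous_intros continuous_on_u_fun cont) auto
  then have "continuous_on (- {0}) (X2 (u_fun p L))"
    by (rule continuous_on_eq) (simp add: X2_u_fun)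
  then show "X2 (u_fun p L) \<in> borel_measurable borel"
    by (rule borel_measurable_continuous_countable_exceptions[rotated]) simp
qed

lemma borel_measurable_grad_weight_u_fun [measurable]:
  "grad_weight p (u_fun p L) \<in> borel_measurable borel"
  unfolding grad_weight_def horizontal_grad_def by measurable

lemma borel_measurable_flux [measurable]: "flux p L \<in> borel_measurable borel"
  unfolding flux_def by measurable

lemma borel_measurable_dil_density [measurable]: "dil_density p L \<in> borel_measurable borel"
  unfolding dil_density_def by measurable

lemma borel_measurable_rot_density [measurable]: "rot_density p L \<in> borel_measurable borel"
  unfolding rot_density_def by measurable

text \<open>The two summands of \<open>1 + sqrt (gauge_sq x)\<close> serve the weighted gradient, of
  degree -3, and the weighted \<open>u\<close>, of degree -2.\<close>

lemma locally_integrable_omega_bound: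
  assumes p: "1 < p" and f[measurable]: "f \<in> borel_measurable borel"
    and bound: "\<And>x. x \<noteq> 0 \<Longrightarrow> norm (f x) \<le> C * (1 + sqrt (gauge_sq x)) * omega p x" and C: "0 \<le> C"
  shows "locally_integrable f"
  unfolding locally_integrable_def
proof (intro allI impI)
  fix K :: "heis set"
  assume K: "compact K"
  have "bounded (gauge_sq ` K)"
    using K by (intro compact_imp_bounded compact_continuous_image continuous_intros)
  then obtain M where M: "\<And>x. x \<in> K \<Longrightarrow> gauge_sq x \<le> M" by (force simp: bounded_iff)
  have [measurable]: "K \<in> sets borel" using K by (simp add: borel_closed compact_imp_closed)
  show "set_integrable lborel K f"
    unfolding set_integrable_def
  proof (rule integrable_bound_omega[OF p])
    fix x :: heis
    assume x: "x \<noteq> 0"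
    show "norm (indicat_real K x *\<^sub>R f x)
      \<le> C * (1 + sqrt \<bar>M\<bar>) * (indicat_real {x. gauge_sq x \<le> M} x * omega p x)"
    proof (cases "x \<in> K")
      case True
      have "C * (1 + sqrt (gauge_sq x)) * omega p x \<le> C * (1 + sqrt \<bar>M\<bar>) * omega p x"
        using M[OF True] C by (intro mult_right_mono mult_left_mono) auto
      with bound[OF x] M[OF True] True show ?thesis by simp
    qed (use C in simp)
  qed measurable
qed

lemma H_op_defined_u_fun:
  assumes p: "1 < p"
  shows "H_op_defined p (u_fun p L)"
proof -
  define c where "c = (8 * ((eta p L)\<^sup>2 + (tau p L)\<^sup>2)) powr ((p - 2) / 2)"
  define d where "d = \<bar>eta p L\<bar> + \<bar>tau p L\<bar>"
  have c: "0 \<le> c" and d: "0 \<le> d" by (simp_all add: c_def d_def)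
  have flux: "norm (flux p L x) = c * (sqrt (gauge_sq x) * omega p x)" for x
    using norm_flux[OF p] by (simp add: c_def)
  \<comment> \<open>One estimate for both frame fields: \<open>k\<close> is 2 or -2i, and the minus
    sign in the formula for X2 is absorbed into \<open>b\<close>.\<close>
  have grad: "norm (grad_weight p (u_fun p L) x * (k * u_fun p L x * (a + b))) \<le> 2 * c * d * omega p x"
    if x: "x \<noteq> 0" and k: "norm k = 2"
      and a: "norm a = \<bar>eta p L\<bar> * sqrt (rsq x) / gauge_sq x"
      and b: "norm b = \<bar>tau p L\<bar> * sqrt (rsq x) / gauge_sq x" for x k a b
  proof -
    have R: "0 < gauge_sq x" using x by (rule gauge_sq_pos)
    have "norm (a + b) \<le> d * (sqrt (rsq x) / gauge_sq x)"
      using norm_triangle_ineq[of a b] unfolding a b d_def by (simp add: distrib_right add_divide_distrib)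
    also have "\<dots> \<le> d * (sqrt (gauge_sq x) / gauge_sq x)"
      using R d rsq_le_gauge_sq[of x] by (intro mult_left_mono divide_right_mono) auto
    finally have ab: "norm (a + b) \<le> d * (sqrt (gauge_sq x) / gauge_sq x)" .
    have "norm (grad_weight p (u_fun p L) x * (k * u_fun p L x * (a + b))) = 2 * norm (flux p L x) * norm (a + b)"
      unfolding flux_eq[OF x, symmetric] norm_mult k by simp
    also have "\<dots> \<le> 2 * norm (flux p L x) * (d * (sqrt (gauge_sq x) / gauge_sq x))"
      by (intro mult_left_mono ab) simp
    also have "\<dots> = 2 * c * d * omega p x * (sqrt (gauge_sq x) * sqrt (gauge_sq x) / gauge_sq x)"
      unfolding flux by (simp only: mult_ac times_divide_eq_right times_divide_eq_left)
    finally show ?thesis using R by simp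
  qed
  have weaken: "r \<le> 2 * c * d * (1 + sqrt (gauge_sq x)) * omega p x" if "r \<le> 2 * c * d * omega p x" for r x
  proof -
    note that
    also have "2 * c * d * omega p x = 2 * c * d * omega p x * 1" by simp
    also have "\<dots> \<le> 2 * c * d * omega p x * (1 + sqrt (gauge_sq x))"
      using c d by (intro mult_left_mono mult_nonneg_nonneg) auto
    also have "\<dots> = 2 * c * d * (1 + sqrt (gauge_sq x)) * omega p x"
      by (simp only: mult_ac)
    finally show ?thesis .
  qed
  have vw: "norm (of_real (eta p L) * Complex (x$1) (x$2) / v_fun x) = \<bar>eta p L\<bar> * sqrt (rsq x) / gauge_sq x"
    "norm (of_real (tau p L) * Complex (x$1) (- x$2) / w_fun x) = \<bar>tau p L\<bar> * sqrt (rsq x) / gauge_sq x" for x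
    by (simp_all add: norm_mult norm_divide complex_norm norm_w_fun rsq_def flip: gauge_sq_def)
  have "locally_integrable (\<lambda>x. grad_weight p (u_fun p L) x * X1 (u_fun p L) x)"
    by (rule locally_integrable_omega_bound[OF p, of _ "2 * c * d"])
       (use c d in \<open>auto simp: X1_u_fun intro!: weaken grad vw\<close>)
  moreover have "locally_integrable (\<lambda>x. grad_weight p (u_fun p L) x * X2 (u_fun p L) x)"
  proof (rule locally_integrable_omega_bound[OF p, of _ "2 * c * d"])
    show "norm (grad_weight p (u_fun p L) x * X2 (u_fun p L) x) \<le> 2 * c * d * (1 + sqrt (gauge_sq x)) * omega p x"
      if "x \<noteq> 0" for x
      unfolding X2_u_fun[OF that] diff_conv_add_uminus
      by (intro weaken grad that) (simp_all only: norm_minus_cancel vw, simp add: norm_mult)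
  qed (use c d in auto)
  moreover have "locally_integrable (\<lambda>x. grad_weight p (u_fun p L) x * u_fun p L x)"
  proof (rule locally_integrable_omega_bound[OF p, of _ c])
    show "norm (grad_weight p (u_fun p L) x * u_fun p L x) \<le> c * (1 + sqrt (gauge_sq x)) * omega p x"
      if "x \<noteq> 0" for x
      unfolding flux_eq[OF that] flux mult.assoc using c by (intro mult_left_mono mult_right_mono) auto
  qed (use c in auto)
  ultimately show ?thesis unfolding H_op_defined_def by blast
qed

subsection \<open>Dilations and rotations\<close>

definition dil :: "real \<Rightarrow> heis \<Rightarrow> heis" where
  "dil s x = vector [exp s * x$1, exp s * x$2, exp (2 * s) * x$3]"

definition rot :: "real \<Rightarrow> heis \<Rightarrow> heis" where
  "rot s x = vector [cos s * x$1 - sin s * x$2, sin s * x$1 + cos s * x$2, x$3]"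

lemma dil_nth [simp]: "dil s x $ 1 = exp s * x$1" "dil s x $ 2 = exp s * x$2" "dil s x $ 3 = exp (2 * s) * x$3"
  by (simp_all add: dil_def)

lemma rot_nth [simp]: "rot s x $ 1 = cos s * x$1 - sin s * x$2" "rot s x $ 2 = sin s * x$1 + cos s * x$2"
  "rot s x $ 3 = x$3"
  by (simp_all add: rot_def)

lemma linear_dil: "linear (dil s)"
  by (rule linearI) (simp_all add: vec_eq_iff forall_3 algebra_simps)

lemma linear_rot: "linear (rot s)"
  by (rule linearI) (simp_all add: vec_eq_iff forall_3 algebra_simps)

lemma det_dil: "det (matrix (dil s)) = exp (4 * s)"
  by (simp add: det_3 matrix_def axis_def flip: exp_add)

lemma det_rot: "det (matrix (rot s)) = 1"
  using sin_cos_squared_add3[of s] by (simp add: det_3 matrix_def axis_def)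

text \<open>Turns \<open>vector\<close>, which is built from a list, into a linear combination that
  the continuity and derivative rules can process.\<close>

lemma vector_3_eq: "(vector [a, b, c] :: heis) = a *\<^sub>R axis 1 1 + b *\<^sub>R axis 2 1 + c *\<^sub>R axis 3 1"
  by (simp add: vec_eq_iff forall_3 axis_def)

lemma continuous_on_dil: "continuous_on UNIV (\<lambda>(s, x). dil s x)"
  unfolding dil_def vector_3_eq case_prod_beta by (intro continuous_intros)

lemma continuous_on_rot: "continuous_on UNIV (\<lambda>(s, x). rot s x)"
  unfolding rot_def vector_3_eq case_prod_beta by (intro continuous_intros)

section \<open>Homogeneity and rotation invariance of the densities\<close>

lemma rsq_dil: "rsq (dil s x) = exp (2 * s) * rsq x"
  by (simp add: rsq_def power_mult_distrib distrib_left flip: exp_double)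

lemma v_fun_dil: "v_fun (dil s x) = of_real (exp (2 * s)) * v_fun x"
  by (simp add: v_fun_eq_Complex rsq_dil complex_eq_iff)

lemma w_fun_dil: "w_fun (dil s x) = of_real (exp (2 * s)) * w_fun x"
  by (simp add: w_fun_eq_Complex rsq_dil complex_eq_iff)

lemma gauge_sq_dil: "gauge_sq (dil s x) = exp (2 * s) * gauge_sq x"
  by (simp add: gauge_sq_def v_fun_dil norm_mult)

lemma rsq_rot: "rsq (rot s x) = rsq x"
proof -
  have "rsq (rot s x) = (cos s * cos s + sin s * sin s) * rsq x"
    unfolding rsq_def rot_nth power2_eq_square by algebra
  then show ?thesis by simp
qed

lemma v_fun_rot: "v_fun (rot s x) = v_fun x"
  by (simp add: v_fun_eq_Complex rsq_rot)

lemma w_fun_rot: "w_fun (rot s x) = w_fun x"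
  by (simp add: w_fun_eq_Complex rsq_rot)

lemma gauge_sq_rot: "gauge_sq (rot s x) = gauge_sq x"
  by (simp add: gauge_sq_def v_fun_rot)

text \<open>A positive real factor does not change the argument, so no branch correction
  arises.\<close>

lemma exp_times_powr_of_real:
  "(of_real (exp r) * z) powr of_real a = of_real (exp (r * a)) * z powr of_real a" for z :: complex
proof -
  have "(of_real (exp r) * z) powr of_real a = of_real (exp r) powr of_real a * z powr of_real a"
    by (rule powr_times_real_left) auto
  also have "complex_of_real (exp r) powr of_real a = of_real (exp r powr a)"
    by (rule powr_of_real) simp
  finally show ?thesis by (simp add: powr_def mult.commute)
qed

lemma exp_times_powr: "(exp r * y) powr a = exp (r * a) * y powr a" for r y a :: real
  unfolding powr_mult by (simp add: powr_def mult.commute)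

lemma u_fun_dil: "u_fun p L (dil s x) = of_real (exp (2 * s * (eta p L + tau p L))) * u_fun p L x"
  unfolding u_fun_def v_fun_dil w_fun_dil exp_times_powr_of_real
  by (simp add: distrib_left exp_add mult_ac)

text \<open>The exponents of the weight, of \<open>rsq\<close> and of \<open>u\<close> add up to
  (\<eta> + \<tau>)(p - 1) - (p - 2)/2, which is -1 by \<open>eta_plus_tau\<close>.\<close>

lemma flux_dil:
  assumes p: "p \<noteq> 1"
  shows "flux p L (dil s x) = of_real (exp (- 2 * s)) * flux p L x"
proof -
  have e: "(eta p L + tau p L - 1) * (p - 2) + (p - 2) / 2 + (eta p L + tau p L) = - 1"
    using eta_plus_tau[OF p, of L] by (simp add: algebra_simps add_divide_distrib diff_divide_distrib)
  have "flux p L (dil s x) = of_real (exp (2 * s * ((eta p L + tau p L - 1) * (p - 2)))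
      * exp (2 * s * ((p - 2) / 2)) * exp (2 * s * (eta p L + tau p L))) * flux p L x"
    unfolding flux_def u_fun_dil gauge_sq_dil rsq_dil exp_times_powr by (simp add: mult_ac)
  also have "exp (2 * s * ((eta p L + tau p L - 1) * (p - 2))) * exp (2 * s * ((p - 2) / 2))
      * exp (2 * s * (eta p L + tau p L)) = exp (2 * s * - 1)"
    unfolding exp_add[symmetric] distrib_left[symmetric] e ..
  finally show ?thesis by simp
qed

text \<open>Degree count: 4 from the determinant, -2 from \<open>flux\<close>, 2 from the numerator
  and -4 from the denominator cancel.\<close>

lemma dil_density_dil:
  assumes p: "p \<noteq> 1"
  shows "\<bar>det (matrix (dil s))\<bar> *\<^sub>R dil_density p L (dil s x) = dil_density p L x"
proof -
  define f where "f = complex_of_real (exp (2 * s))"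
  have f: "f \<noteq> 0" "of_real (exp (- 2 * s)) = inverse f" "of_real (exp (4 * s)) = f * f"
    by (simp_all add: f_def exp_minus flip: of_real_mult exp_add)
  have num: "of_real (a * (exp (2 * s) * q)) + 4 * \<i> * of_real (b * (exp (2 * s) * t))
      = f * (of_real (a * q) + 4 * \<i> * of_real (b * t))" for a b q t
    by (simp add: f_def algebra_simps)
  have den: "of_real ((exp (2 * s) * g)\<^sup>2) = f * f * of_real (g\<^sup>2)" for g
    by (simp add: f_def power2_eq_square)
  have "\<bar>det (matrix (dil s))\<bar> *\<^sub>R dil_density p L (dil s x)
     = f * f * (2 * (inverse f * flux p L x) * (f * (of_real ((eta p L + tau p L) * rsq x)
         + 4 * \<i> * of_real ((eta p L - tau p L) * x$3))) / (f * f * of_real ((gauge_sq x)\<^sup>2)))"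
    unfolding det_dil dil_density_def flux_dil[OF p] gauge_sq_dil rsq_dil dil_nth num den f(2)
      scaleR_conv_of_real abs_exp_cancel f(3) ..
  also have "\<dots> = dil_density p L x"
    using f(1) by (simp add: dil_density_def)
  finally show ?thesis .
qed

lemma flux_rot: "flux p L (rot s x) = flux p L x"
  by (simp add: flux_def u_fun_def v_fun_rot w_fun_rot rsq_rot gauge_sq_rot)

lemma rot_density_rot: "\<bar>det (matrix (rot s))\<bar> *\<^sub>R rot_density p L (rot s x) = rot_density p L x"
  by (simp add: det_rot rot_density_def flux_rot rsq_rot gauge_sq_rot)

section \<open>Test functions along the two flows\<close>

lemma has_vector_derivative_curve:
  assumes \<phi>: "test_function \<phi>" and c: "(c has_vector_derivative d) (at s)"
  shows "((\<lambda>s. \<phi> (c s)) has_vector_derivative (\<Sum>i\<in>UNIV. d$i *\<^sub>R partial i \<phi> (c s))) (at s)"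
proof -
  have "((\<lambda>s. \<phi> (c s)) has_derivative (\<lambda>r. \<Sum>i\<in>UNIV. (r *\<^sub>R d)$i *\<^sub>R partial i \<phi> (c s))) (at s)"
    using has_derivative_compose[OF c[unfolded has_vector_derivative_def]
        has_derivative_partial[OF test_function_differentiable[OF \<phi>]]] .
  then show ?thesis
    unfolding has_vector_derivative_def by (simp add: scaleR_sum_right)
qed

lemma has_vector_derivative_dil:
  assumes "test_function \<phi>"
  shows "((\<lambda>s. \<phi> (dil s x)) has_vector_derivative dil_field \<phi> (dil s x)) (at s)"
proof -
  have "((\<lambda>s. dil s x) has_vector_derivative
     (exp s * x$1) *\<^sub>R axis 1 1 + (exp s * x$2) *\<^sub>R axis 2 1 + (2 * exp (2 * s) * x$3) *\<^sub>R axis 3 1) (at s)"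
    unfolding dil_def vector_3_eq
    by (auto intro!: derivative_eq_intros has_vector_derivative_scaleR
        simp flip: has_real_derivative_iff_has_vector_derivative)
  from has_vector_derivative_curve[OF assms this] show ?thesis
    by (simp add: sum_3 axis_def dil_field_def scaleR_conv_of_real[of _ "z :: complex" for z] mult_ac)
qed

lemma has_vector_derivative_rot:
  assumes "test_function \<phi>"
  shows "((\<lambda>s. \<phi> (rot s x)) has_vector_derivative rot_field \<phi> (rot s x)) (at s)"
proof -
  have "((\<lambda>s. rot s x) has_vector_derivative
     (- (sin s * x$1 + cos s * x$2)) *\<^sub>R axis 1 1 + (cos s * x$1 - sin s * x$2) *\<^sub>R axis 2 1) (at s)"
    unfolding rot_def vector_3_eq
    by (auto intro!: derivative_eq_intros has_vector_derivative_scaleR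
        simp flip: has_real_derivative_iff_has_vector_derivative)
  from has_vector_derivative_curve[OF assms this] show ?thesis
    by (simp add: sum_3 axis_def rot_field_def scaleR_conv_of_real[of _ "z :: complex" for z] algebra_simps)
qed

subsection \<open>The fundamental solution\<close>

lemma test_function_bounds:
  assumes \<phi>: "test_function \<phi>"
  obtains B M where "0 \<le> B" "1 \<le> M" "\<And>i x. norm (partial i \<phi> x) \<le> B"
    "\<And>x. M < gauge_sq x \<Longrightarrow> \<phi> x = 0" "\<And>i x. M < gauge_sq x \<Longrightarrow> partial i \<phi> x = 0"
proof -
  let ?K = "closure {x. \<phi> x \<noteq> 0}"
  have "bounded (gauge_sq ` ?K)"
    using \<phi> unfolding test_function_def
    by (intro compact_imp_bounded compact_continuous_image continuous_intros) simp
  then obtain M where M: "\<And>x. x \<in> ?K \<Longrightarrow> gauge_sq x \<le> M" by (force simp: bounded_iff)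
  have "\<exists>B. 0 \<le> B \<and> (\<forall>x. norm (partial i \<phi> x) \<le> B)" for i
    using test_function_bounded[OF test_function_partial[OF \<phi>, of i]] by blast
  then obtain B where B: "\<And>i. 0 \<le> B i" "\<And>i x. norm (partial i \<phi> x) \<le> B i" by metis
  have "norm (partial i \<phi> x) \<le> (\<Sum>i\<in>UNIV. B i)" for i x
  proof -
    have "B i \<le> (\<Sum>i\<in>UNIV. B i)" using B(1) by (intro member_le_sum) auto
    with B(2)[of i x] show ?thesis by (rule order_trans)
  qed
  moreover have out: "x \<notin> ?K" if "max M 1 < gauge_sq x" for x
    using M[of x] that by auto
  then have "\<phi> x = 0" if "max M 1 < gauge_sq x" for x
    using closure_subset[of "{x. \<phi> x \<noteq> 0}"] that by blast
  moreover have "partial i \<phi> x = 0" if "max M 1 < gauge_sq x" for i x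
    using out[OF that] by (rule partial_eq_0)
  moreover have "0 \<le> (\<Sum>i\<in>UNIV. B i)" using B(1) by (simp add: sum_nonneg)
  ultimately show thesis using that[of "\<Sum>i\<in>UNIV. B i" "max M 1"] by simp
qed

lemma height_le_sqrt_gauge_sq:
  assumes "gauge_sq x \<le> M"
  shows "\<bar>x$3\<bar> \<le> sqrt M * sqrt (gauge_sq x)"
proof -
  have "\<bar>x$3\<bar> \<le> sqrt (gauge_sq x) * sqrt (gauge_sq x)"
    using height_le_gauge_sq[of x] by simp
  also have "\<dots> \<le> sqrt M * sqrt (gauge_sq x)"
    using assms by (intro mult_right_mono) auto
  finally show ?thesis .
qed

text \<open>The coefficients vanish at the origin: \<open>x$1\<close> and \<open>x$2\<close> are
  bounded by the gauge, and \<open>x$3\<close>, bounded by its square, is reduced to one power on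
  the support at the cost of \<open>sqrt M\<close>.\<close>

lemma field_bounds:
  assumes \<phi>: "test_function \<phi>"
  obtains B M where "0 \<le> B"
    "\<And>x. norm (dil_field \<phi> x) \<le> B * (sqrt (gauge_sq x) * indicat_real {x. gauge_sq x \<le> M} x)"
    "\<And>x. norm (rot_field \<phi> x) \<le> B * (sqrt (gauge_sq x) * indicat_real {x. gauge_sq x \<le> M} x)"
proof -
  obtain B M where B: "0 \<le> B" "\<And>i x. norm (partial i \<phi> x) \<le> B"
    and M: "1 \<le> M" "\<And>i x. M < gauge_sq x \<Longrightarrow> partial i \<phi> x = 0"
    using test_function_bounds[OF \<phi>] by metis
  have summand: "norm (of_real c * partial i \<phi> x) \<le> k * sqrt (gauge_sq x) * B"
    if "\<bar>c\<bar> \<le> k * sqrt (gauge_sq x)" for c k i x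
    unfolding norm_mult norm_of_real using that B by (intro mult_mono) auto
  define C where "C = 2 * B + 2 * sqrt M * B"
  have x: "\<bar>x$1\<bar> \<le> 1 * sqrt (gauge_sq x)" "\<bar>x$2\<bar> \<le> 1 * sqrt (gauge_sq x)" for x
    using coord_le_gauge_sq by simp_all
  have "norm (dil_field \<phi> x) \<le> C * (sqrt (gauge_sq x) * indicat_real {x. gauge_sq x \<le> M} x)" for x
  proof (cases "gauge_sq x \<le> M")
    case True
    have "norm (dil_field \<phi> x) \<le> norm (of_real (x$1) * partial 1 \<phi> x) + norm (of_real (x$2) * partial 2 \<phi> x)
        + 2 * norm (of_real (x$3) * partial 3 \<phi> x)"
      unfolding dil_field_def
      by (intro norm_triangle_le add_mono order_refl) (simp_all add: norm_mult)
    also have "\<dots> \<le> 1 * sqrt (gauge_sq x) * B + 1 * sqrt (gauge_sq x) * B + 2 * (sqrt M * sqrt (gauge_sq x) * B)"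
      by (intro add_mono mult_left_mono summand x height_le_sqrt_gauge_sq True) simp
    finally show ?thesis using True by (simp add: C_def algebra_simps)
  qed (use M(2)[of x] in \<open>simp add: dil_field_def\<close>)
  moreover have "norm (rot_field \<phi> x) \<le> C * (sqrt (gauge_sq x) * indicat_real {x. gauge_sq x \<le> M} x)" for x
  proof (cases "gauge_sq x \<le> M")
    case True
    have "norm (rot_field \<phi> x) \<le> norm (of_real (x$1) * partial 2 \<phi> x) + norm (of_real (x$2) * partial 1 \<phi> x)"
      unfolding rot_field_def by (rule norm_triangle_ineq4)
    also have "\<dots> \<le> 1 * sqrt (gauge_sq x) * B + 1 * sqrt (gauge_sq x) * B"
      by (intro add_mono summand x)
    also have "\<dots> \<le> C * sqrt (gauge_sq x)"
      using B(1) M(1) by (simp add: C_def algebra_simps)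
    finally show ?thesis using True by simp
  qed (use M(2)[of x] in \<open>simp add: rot_field_def\<close>)
  moreover have "0 \<le> C" using B M by (simp add: C_def)
  ultimately show thesis using that by blast
qed

text \<open>Here \<open>r\<close> is the gauge, \<open>w\<close> is \<open>omega\<close> and
  \<open>i\<close> an indicator: the power of the gauge found in the field is spent on the
  density.\<close>

lemma norm_mult_density_le:
  fixes k v :: complex
  assumes K: "norm k * r \<le> C * w" and v: "norm v \<le> B * (r * i)" and "0 \<le> B" "0 \<le> i"
  shows "norm (k * v) \<le> C * B * (i * w)"
proof -
  have "norm (k * v) \<le> norm k * (B * (r * i))"
    unfolding norm_mult using v by (rule mult_left_mono) simp
  also have "\<dots> = B * i * (norm k * r)" by simp
  also have "\<dots> \<le> B * i * (C * w)"
    using assms by (intro mult_left_mono) auto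
  finally show ?thesis by (simp add: mult_ac)
qed

lemma continuous_on_dil_field: "test_function \<phi> \<Longrightarrow> continuous_on UNIV (dil_field \<phi>)"
  unfolding dil_field_def by (intro continuous_intros test_function_continuous test_function_partial)

lemma continuous_on_rot_field: "test_function \<phi> \<Longrightarrow> continuous_on UNIV (rot_field \<phi>)"
  unfolding rot_field_def by (intro continuous_intros test_function_continuous test_function_partial)

lemma
  assumes p: "1 < p" and \<phi>: "test_function \<phi>"
  shows integrable_dil_field: "integrable lborel (\<lambda>x. dil_density p L x * dil_field \<phi> x)"
    and integrable_rot_field: "integrable lborel (\<lambda>x. rot_density p L x * rot_field \<phi> x)"
proof -
  note [measurable] = borel_measurable_continuous_onI[OF continuous_on_dil_field[OF \<phi>]]
    borel_measurable_continuous_onI[OF continuous_on_rot_field[OF \<phi>]]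
  obtain C where C: "0 \<le> C" "\<And>x. norm (dil_density p L x) * sqrt (gauge_sq x) \<le> C * omega p x"
    "\<And>x. norm (rot_density p L x) * sqrt (gauge_sq x) \<le> C * omega p x"
    using density_bound[OF p] by metis
  obtain B M where B: "0 \<le> B"
    "\<And>x. norm (dil_field \<phi> x) \<le> B * (sqrt (gauge_sq x) * indicat_real {x. gauge_sq x \<le> M} x)"
    "\<And>x. norm (rot_field \<phi> x) \<le> B * (sqrt (gauge_sq x) * indicat_real {x. gauge_sq x \<le> M} x)"
    using field_bounds[OF \<phi>] by metis
  show "integrable lborel (\<lambda>x. dil_density p L x * dil_field \<phi> x)"
    by (rule integrable_bound_omega[OF p _ norm_mult_density_le[OF C(2) B(2)]]) (use B in simp_all)
  show "integrable lborel (\<lambda>x. rot_density p L x * rot_field \<phi> x)"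
    by (rule integrable_bound_omega[OF p _ norm_mult_density_le[OF C(3) B(3)]]) (use B in simp_all)
qed

lemma integral_rot_field:
  assumes p: "1 < p" and \<phi>: "test_function \<phi>"
  shows "(\<integral>x. rot_density p L x * rot_field \<phi> x \<partial>lborel) = 0"
proof -
  obtain C where C: "0 \<le> C" "\<And>x. norm (rot_density p L x) * sqrt (gauge_sq x) \<le> C * omega p x"
    using density_bound[OF p] by metis
  obtain B M where B: "0 \<le> B"
    "\<And>x. norm (rot_field \<phi> x) \<le> B * (sqrt (gauge_sq x) * indicat_real {x. gauge_sq x \<le> M} x)"
    using field_bounds[OF \<phi>] by metis
  have "of_real (2 * pi) * (\<integral>x. rot_density p L x * rot_field \<phi> x \<partial>lborel)
      = (\<integral>x. rot_density p L x * (\<phi> (rot (2 * pi) x) - \<phi> (rot 0 x)) \<partial>lborel)"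
  proof (rule integral_flow_derivative[where g = rot])
    show "AE x in lborel. \<forall>s\<in>{0..2 * pi}. norm (rot_density p L x * rot_field \<phi> (rot s x))
        \<le> C * B * (indicat_real {x. gauge_sq x \<le> M} x * omega p x)"
    proof (intro AE_I2 ballI)
      fix x s
      have "norm (rot_field \<phi> (rot s x)) \<le> B * (sqrt (gauge_sq x) * indicat_real {x. gauge_sq x \<le> M} x)"
        using B(2)[of "rot s x"] by (simp add: gauge_sq_rot indicator_def)
      from norm_mult_density_le[OF C(2) this B(1)]
      show "norm (rot_density p L x * rot_field \<phi> (rot s x))
          \<le> C * B * (indicat_real {x. gauge_sq x \<le> M} x * omega p x)" by simp
    qed
  qed (use det_rot rot_density_rot in \<open>auto intro: linear_rot continuous_on_rot continuous_on_rot_field[OF \<phi>]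
        has_vector_derivative_rot[OF \<phi>] integrable_omega[OF p]\<close>)
  moreover have "rot (2 * pi) x = rot 0 x" for x by (simp add: vec_eq_iff forall_3)
  ultimately show ?thesis by simp
qed

text \<open>The dilation flow yields the integral of \<open>dil_density\<close> against \<open>\<phi> \<circ> dil 1 - \<phi>\<close>, whose two terms
  are not integrable separately. Subtracting \<open>\<phi> 0\<close> times the indicator of the unit gauge ball makes
  them integrable, and then they cancel by homogeneity; only the indicators remain.\<close>

lemma integral_dil_field:
  assumes p: "1 < p" and \<phi>: "test_function \<phi>"
  shows "(\<integral>x. dil_density p L x * dil_field \<phi> x \<partial>lborel)
    = (\<integral>x. dil_density p L x * (indicator {x. gauge_sq x \<le> 1} (dil 1 x) - indicator {x. gauge_sq x \<le> 1} x) \<partial>lborel) * \<phi> 0"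
proof -
  let ?K = "dil_density p L" and ?i = "indicator {x. gauge_sq x \<le> 1} :: heis \<Rightarrow> complex"
  define \<psi> where "\<psi> x = \<phi> x - \<phi> 0 * ?i x" for x
  have p1: "p \<noteq> 1" using p by simp
  have [measurable]: "\<phi> \<in> borel_measurable borel"
    using test_function_continuous[OF \<phi>] by (rule borel_measurable_continuous_onI)
  have [measurable]: "dil s \<in> borel_measurable borel" for s
    using linear_dil by (simp add: borel_measurable_continuous_onI linear_continuous_on linear_linear)
  have [measurable]: "\<psi> \<in> borel_measurable borel" unfolding \<psi>_def by measurable
  obtain C where C: "0 \<le> C" "\<And>x. norm (?K x) * sqrt (gauge_sq x) \<le> C * omega p x"
    using density_bound[OF p] by metis
  obtain B M where B: "0 \<le> B"
    "\<And>x. norm (dil_field \<phi> x) \<le> B * (sqrt (gauge_sq x) * indicat_real {x. gauge_sq x \<le> M} x)"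
    using field_bounds[OF \<phi>] by metis
  have "of_real 1 * (\<integral>x. ?K x * dil_field \<phi> x \<partial>lborel) = (\<integral>x. ?K x * (\<phi> (dil 1 x) - \<phi> (dil 0 x)) \<partial>lborel)"
  proof (rule integral_flow_derivative[where g = dil])
    show "AE x in lborel. \<forall>s\<in>{0..1}. norm (?K x * dil_field \<phi> (dil s x))
        \<le> C * (B * exp 1) * (indicat_real {x. gauge_sq x \<le> M} x * omega p x)"
    proof (intro AE_I2 ballI)
      fix x and s :: real
      assume s: "s \<in> {0..1}"
      have "sqrt (exp (2 * s)) = exp s" by (simp add: exp_double)
      then have sqrt: "sqrt (gauge_sq (dil s x)) \<le> exp 1 * sqrt (gauge_sq x)"
        using s unfolding gauge_sq_dil real_sqrt_mult by (auto intro!: mult_right_mono)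
      have "1 * gauge_sq x \<le> exp (2 * s) * gauge_sq x"
        using s by (intro mult_right_mono) auto
      \<comment> \<open>For \<open>s\<close> at least 0 dilations move points outward, so the cutoff
        at the moved point implies the cutoff at \<open>x\<close>, uniformly in
        \<open>s\<close>.\<close>
      then have ind: "indicat_real {x. gauge_sq x \<le> M} (dil s x) \<le> indicat_real {x. gauge_sq x \<le> M} x"
        by (auto simp: indicator_def gauge_sq_dil)
      have "norm (dil_field \<phi> (dil s x)) \<le> B * (sqrt (gauge_sq (dil s x)) * indicat_real {x. gauge_sq x \<le> M} (dil s x))"
        by (rule B(2))
      also have "\<dots> \<le> B * ((exp 1 * sqrt (gauge_sq x)) * indicat_real {x. gauge_sq x \<le> M} x)"
        using sqrt ind B(1) by (intro mult_left_mono mult_mono) auto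
      finally have "norm (dil_field \<phi> (dil s x)) \<le> B * exp 1 * (sqrt (gauge_sq x) * indicat_real {x. gauge_sq x \<le> M} x)"
        by (simp add: mult_ac)
      from norm_mult_density_le[OF C(2) this]
      show "norm (?K x * dil_field \<phi> (dil s x))
          \<le> C * (B * exp 1) * (indicat_real {x. gauge_sq x \<le> M} x * omega p x)" using B(1) by simp
    qed
  qed (use det_dil dil_density_dil[OF p1] in \<open>auto intro: linear_dil continuous_on_dil continuous_on_dil_field[OF \<phi>]
        has_vector_derivative_dil[OF \<phi>] integrable_omega[OF p]\<close>)
  moreover have "dil 0 x = x" for x by (simp add: vec_eq_iff forall_3)
  ultimately have flow: "(\<integral>x. ?K x * dil_field \<phi> x \<partial>lborel) = (\<integral>x. ?K x * (\<phi> (dil 1 x) - \<phi> x) \<partial>lborel)"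
    by simp
  have \<psi>_int: "integrable lborel (\<lambda>x. ?K x * \<psi> x)"
  proof -
    obtain B M where B: "0 \<le> B" "\<And>i x. norm (partial i \<phi> x) \<le> B"
      and M: "1 \<le> M" "\<And>x. M < gauge_sq x \<Longrightarrow> \<phi> x = 0"
      using test_function_bounds[OF \<phi>] by metis
    obtain A where A: "0 \<le> A" "\<And>x. norm (\<phi> x) \<le> A" using test_function_bounded[OF \<phi>] by metis
    have lip: "norm (\<phi> x - \<phi> 0) \<le> 3 * B * norm (x - 0)" for x
    proof (rule differentiable_bound)
      show "(\<phi> has_derivative (\<lambda>h. \<Sum>i\<in>UNIV. h$i *\<^sub>R partial i \<phi> y)) (at y within UNIV)" for y
        using has_derivative_partial[OF test_function_differentiable[OF \<phi>]] by simp
      show "onorm (\<lambda>h. \<Sum>i\<in>UNIV. h$i *\<^sub>R partial i \<phi> y) \<le> 3 * B" for y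
      proof (rule onorm_bound)
        fix h :: heis
        have "norm (\<Sum>i\<in>UNIV. h$i *\<^sub>R partial i \<phi> y) \<le> (\<Sum>i\<in>(UNIV :: 3 set). norm h * B)"
          by (rule sum_norm_le) (auto intro!: mult_mono component_le_norm_cart B)
        then show "norm (\<Sum>i\<in>UNIV. h$i *\<^sub>R partial i \<phi> y) \<le> 3 * B * norm h"
          by (simp add: mult_ac)
      qed (use B in simp)
    qed auto
    \<comment> \<open>Inside the unit gauge ball the Lipschitz constant \<open>3 * B\<close> meets
      \<open>norm x\<close>, at most three times the gauge, giving 9 B. Between 1 and
      \<open>M\<close> the function is \<phi> itself and the gauge exceeds 1, so the sup bound
      \<open>A\<close> suffices. Beyond \<open>M\<close>, which is at least 1, both parts
      vanish.\<close>
    have "norm (\<psi> x) \<le> (9 * B + A) * (sqrt (gauge_sq x) * indicat_real {x. gauge_sq x \<le> M} x)" for x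
    proof -
      consider "gauge_sq x \<le> 1" | "1 < gauge_sq x" "gauge_sq x \<le> M" | "M < gauge_sq x" by linarith
      then show ?thesis
      proof cases
        case 1
        have "norm x \<le> \<bar>x$1\<bar> + \<bar>x$2\<bar> + \<bar>x$3\<bar>"
          using norm_le_l1_cart[of x] by (simp add: sum_3)
        also have "\<dots> \<le> 3 * sqrt (gauge_sq x)"
          using coord_le_gauge_sq[of x] height_le_sqrt_gauge_sq[OF 1] by simp
        finally have "3 * B * norm x \<le> 3 * B * (3 * sqrt (gauge_sq x))"
          using B(1) by (intro mult_left_mono) auto
        then have "norm (\<psi> x) \<le> 9 * B * sqrt (gauge_sq x)"
          using lip[of x] 1 by (simp add: \<psi>_def)
        also have "\<dots> \<le> (9 * B + A) * sqrt (gauge_sq x)"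
          using A(1) by (intro mult_right_mono) auto
        finally show ?thesis using 1 M(1) by simp
      next
        case 2
        have "norm (\<psi> x) \<le> A * 1" using A(2)[of x] 2 by (simp add: \<psi>_def)
        also have "\<dots> \<le> (9 * B + A) * sqrt (gauge_sq x)"
          using A(1) B(1) 2 by (intro mult_mono) auto
        finally show ?thesis using 2 by simp
      next
        case 3
        then show ?thesis using M by (simp add: \<psi>_def)
      qed
    qed
    from norm_mult_density_le[OF C(2) this]
    show ?thesis
      by (intro integrable_bound_omega[OF p, where C = "C * (9 * B + A)" and M = M]) (use A B in simp_all)
  qed
  have dil_eq: "?K x * \<psi> (dil 1 x) = \<bar>det (matrix (dil 1))\<bar> *\<^sub>R (?K (dil 1 x) * \<psi> (dil 1 x))" for x
    using dil_density_dil[OF p1, of 1 L x] by (metis mult_scaleR_left)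
  have dil_\<psi>: "integrable lborel (\<lambda>x. ?K x * \<psi> (dil 1 x))"
    unfolding dil_eq
    by (intro integrable_scaleR_right integrable_lborel_linear[OF linear_dil _ _ \<psi>_int])
       (simp add: det_dil, measurable)
  have "(\<integral>x. ?K x * \<psi> x \<partial>lborel) = \<bar>det (matrix (dil 1))\<bar> *\<^sub>R (\<integral>x. ?K (dil 1 x) * \<psi> (dil 1 x) \<partial>lborel)"
    by (intro integral_lborel_linear linear_dil) (simp add: det_dil, measurable)
  also have "\<dots> = (\<integral>x. ?K x * \<psi> (dil 1 x) \<partial>lborel)"
    unfolding dil_eq by simp
  finally have cancel: "(\<integral>x. ?K x * \<psi> x \<partial>lborel) = (\<integral>x. ?K x * \<psi> (dil 1 x) \<partial>lborel)" .
  have shell: "integrable lborel (\<lambda>x. ?K x * (?i (dil 1 x) - ?i x))"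
  proof -
    \<comment> \<open>The difference lives on the shell
      \<open>exp (- 2) < gauge_sq x \<le> 1\<close>, away from the origin, where
      \<open>exp 1 * sqrt (gauge_sq x)\<close> exceeds 1.\<close>
    have "norm (?i (dil 1 x) - ?i x) \<le> exp 1 * (sqrt (gauge_sq x) * indicat_real {x. gauge_sq x \<le> 1} x)" for x
    proof -
      have "1 * gauge_sq x \<le> exp 2 * gauge_sq x" by (intro mult_right_mono) auto
      then have sub: "gauge_sq (dil 1 x) \<le> 1 \<Longrightarrow> gauge_sq x \<le> 1" by (simp add: gauge_sq_dil)
      show ?thesis
      proof (cases "gauge_sq x \<le> 1 \<and> 1 < gauge_sq (dil 1 x)")
        case True
        have "sqrt (gauge_sq (dil 1 x)) = exp 1 * sqrt (gauge_sq x)"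
          using exp_double[of "1::real"] by (simp add: gauge_sq_dil real_sqrt_mult)
        moreover have "1 < sqrt (gauge_sq (dil 1 x))" using True by simp
        ultimately show ?thesis using True by (simp add: indicator_def)
      next
        case False
        then have "?i (dil 1 x) - ?i x = 0" using sub by (auto simp: indicator_def)
        then show ?thesis by simp
      qed
    qed
    from norm_mult_density_le[OF C(2) this]
    show ?thesis
      by (intro integrable_bound_omega[OF p, where C = "C * exp 1" and M = 1]) simp_all
  qed
  \<comment> \<open>Substituting \<phi> = \<psi> + \<phi>(0) times the indicator: the \<psi> terms
    cancel, and the shell integral remains as coefficient.\<close>
  have "(\<integral>x. ?K x * (\<phi> (dil 1 x) - \<phi> x) \<partial>lborel)
     = (\<integral>x. (?K x * \<psi> (dil 1 x) - ?K x * \<psi> x) + ?K x * (?i (dil 1 x) - ?i x) * \<phi> 0 \<partial>lborel)"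
    by (intro Bochner_Integration.integral_cong) (simp_all add: \<psi>_def algebra_simps)
  also have "\<dots> = (\<integral>x. ?K x * (?i (dil 1 x) - ?i x) \<partial>lborel) * \<phi> 0"
    using \<psi>_int dil_\<psi> shell cancel by simp
  finally show ?thesis unfolding flow .
qed

theorem theorem4p1:
  fixes p L :: real
  assumes "1 < p"
    and "L \<noteq> (4 - p) / (2 * (1 - p))"
    and "L \<noteq> - ((4 - p) / (2 * (1 - p)))"
  shows "H_op_defined p (u_fun p L)
    \<and> (\<exists>C::complex. distr_eq (H_op p L (u_fun p L)) (\<lambda>\<phi>. C * dirac \<phi>))"
proof -
  let ?u = "u_fun p L"
  \<comment> \<open>This is minus the integral of \<open>dil_density\<close> over the shell
    \<open>exp (- 2) < gauge_sq x \<le> 1\<close>, and the constant sought is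
    \<open>- J\<close>.\<close>
  define J where "J = (\<integral>x. dil_density p L x * (indicator {x. gauge_sq x \<le> 1} (dil 1 x)
      - indicator {x. gauge_sq x \<le> 1} x) \<partial>lborel)"
  have p1: "p \<noteq> 1" using assms(1) by simp
  have dfd: "H_op_defined p ?u" using assms(1) by (rule H_op_defined_u_fun)
  let ?F1 = "\<lambda>x. grad_weight p ?u x * X1 ?u x" and ?F2 = "\<lambda>x. grad_weight p ?u x * X2 ?u x"
    and ?G = "\<lambda>x. grad_weight p ?u x * ?u x"
  have loc: "locally_integrable ?F1" "locally_integrable ?F2" "locally_integrable ?G"
    using dfd unfolding H_op_defined_def by blast+
  have "H_op p L ?u \<phi> = - J * dirac \<phi>" if \<phi>: "test_function \<phi>" for \<phi>
  proof -
    let ?S = "closure {x. \<phi> x \<noteq> 0}"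
    have S: "compact ?S" using \<phi> unfolding test_function_def by blast
    note cont = test_function_continuous[OF test_function_partial[OF \<phi>]]
    have int: "integrable lborel (\<lambda>x. f x * h x)"
      if "locally_integrable f" "continuous_on UNIV h" "\<And>x. x \<notin> ?S \<Longrightarrow> h x = 0" for f h
      using locally_integrable_mult[OF that(1) S that(2) that(3)] by simp
    have 1: "integrable lborel (\<lambda>x. ?F1 x * X1 \<phi> x)"
      by (rule int[OF loc(1)]) (auto simp: X1_def[abs_def] partial_eq_0 intro!: continuous_intros cont)
    have 2: "integrable lborel (\<lambda>x. ?F2 x * X2 \<phi> x)"
      by (rule int[OF loc(2)]) (auto simp: X2_def[abs_def] partial_eq_0 intro!: continuous_intros cont)
    have 3: "integrable lborel (\<lambda>x. ?G x * partial 3 \<phi> x)"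
      by (rule int[OF loc(3)]) (auto simp: partial_eq_0 intro!: cont)
    have 4: "integrable lborel (\<lambda>x. ?G x * X1 (X2 \<phi>) x)" "integrable lborel (\<lambda>x. ?G x * X2 (X1 \<phi>) x)"
      using test_function_X_commutator[OF \<phi>] by (intro int loc; simp)+
    \<comment> \<open>Passing to the test function reverses the order of the fields and the two
      minus signs cancel, so the bracket pairs with minus the vertical derivative. This is the same
      sign as in the divergence terms.\<close>
    have "distr_bracket distr_X1 distr_X2 (distr_of ?G) \<phi>
        = (\<integral>x. ?G x * X2 (X1 \<phi>) x \<partial>lborel) - (\<integral>x. ?G x * X1 (X2 \<phi>) x \<partial>lborel)"
      by (simp add: distr_bracket_def distr_X1_def distr_X2_def distr_of_def)
    also have "\<dots> = (\<integral>x. ?G x * X2 (X1 \<phi>) x - ?G x * X1 (X2 \<phi>) x \<partial>lborel)"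
      using 4 by simp
    also have "\<dots> = (\<integral>x. - (?G x * partial 3 \<phi> x) \<partial>lborel)"
      unfolding test_function_X_commutator(1)[OF \<phi>, symmetric] by (simp add: algebra_simps)
    finally have bracket: "distr_bracket distr_X1 distr_X2 (distr_of ?G) \<phi> = - (\<integral>x. ?G x * partial 3 \<phi> x \<partial>lborel)"
      by simp
    have "H_op p L ?u \<phi> = - ((\<integral>x. ?F1 x * X1 \<phi> x \<partial>lborel) + (\<integral>x. ?F2 x * X2 \<phi> x \<partial>lborel)
        + (\<integral>x. \<i> * of_real L * (?G x * partial 3 \<phi> x) \<partial>lborel))"
      unfolding H_op_def bracket p_Laplacian_def
      by (simp add: distr_X1_def distr_X2_def distr_of_def)
    also have "\<dots> = - (\<integral>x. ?F1 x * X1 \<phi> x + ?F2 x * X2 \<phi> x + \<i> * of_real L * (?G x * partial 3 \<phi> x) \<partial>lborel)"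
      using 1 2 3 by simp
    also have "(\<integral>x. ?F1 x * X1 \<phi> x + ?F2 x * X2 \<phi> x + \<i> * of_real L * (?G x * partial 3 \<phi> x) \<partial>lborel)
        = (\<integral>x. dil_density p L x * dil_field \<phi> x + rot_density p L x * rot_field \<phi> x \<partial>lborel)"
    \<comment> \<open>The pointwise identity is known only off the origin, hence the
      almost-everywhere comparison.\<close>
    proof (rule integral_cong_AE)
      have "AE x in lborel. (x :: heis) \<noteq> 0"
        using AE_lborel_vec_nth_neq_0[of 1] by eventually_elim auto
      then show "AE x in lborel. ?F1 x * X1 \<phi> x + ?F2 x * X2 \<phi> x + \<i> * of_real L * (?G x * partial 3 \<phi> x)
          = dil_density p L x * dil_field \<phi> x + rot_density p L x * rot_field \<phi> x"
        by eventually_elim (rule divergence_form[OF p1])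
    next
      show "(\<lambda>x. ?F1 x * X1 \<phi> x + ?F2 x * X2 \<phi> x + \<i> * of_real L * (?G x * partial 3 \<phi> x)) \<in> borel_measurable lborel"
        using 1 2 3 by (intro borel_measurable_integrable Bochner_Integration.integrable_add integrable_mult_right)
      show "(\<lambda>x. dil_density p L x * dil_field \<phi> x + rot_density p L x * rot_field \<phi> x) \<in> borel_measurable lborel"
        by (intro borel_measurable_integrable Bochner_Integration.integrable_add integrable_dil_field
            integrable_rot_field assms(1) \<phi>)
    qed
    also have "\<dots> = J * \<phi> 0"
      using assms(1) \<phi>
      by (simp add: integrable_dil_field integrable_rot_field integral_rot_field integral_dil_field J_def)
    finally show ?thesis by (simp add: dirac_def)
  qed
  with dfd show ?thesis unfolding distr_eq_def by blast
qed

end
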